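(* Let $\mathcal{S}_1,\dots,\mathcal{S}_\ell$ be the segments, from left to right, of the ramification polygon of an Eisenstein polynomial $\varphi\in\mathcal{O}_K[x]$. For $1\le i\le\ell$ let $-h_i/e_i$ be the slope of $\mathcal{S}_i$ and $\underline A_i\in\underline K[x]$ its residual polynomial. Then $$\mathcal{A}=\left\{\left(\gamma_{\delta,1}\underline A_1(\delta^{h_1}x),\dots,\gamma_{\delta,\ell}\underline A_\ell(\delta^{h_\ell}x)\right):\delta\in\underline K^\times\right\},$$ where $\gamma_{\delta,\ell}=\delta^{-h_\ell\deg\underline A_\ell}$ and $\gamma_{\delta,i}=\gamma_{\delta,i+1}\delta^{-h_i\deg\underline A_i}$ for $1\le i\le\ell-1$, is an invariant of the extension $K[x]/(\varphi)$ of $K$; that is, if $\psi\in\mathcal{O}_K[x]$ is another Eisenstein polynomial with $K[x]/(\psi)\cong K[x]/(\varphi)$ over $K$, then the set $\mathcal{A}$ constructed from $\psi$ equals the set $\mathcal{A}$ constructed from $\varphi$.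
   Context: Let $p$ be a prime, $K$ a finite extension of $\mathbb{Q}_p$ with valuation ring $\mathcal{O}_K$, uniformizer $\pi$ and residue field $\underline K=\mathcal{O}_K/(\pi)$; $\underline\gamma$ denotes a residue class. Let $\varphi\in\mathcal{O}_K[x]$ be Eisenstein of degree $n$, $\alpha$ a root, $L=K(\alpha)$ (totally ramified, residue field $\underline K$), and $v_\alpha$ the valuation of $L$ with $v_\alpha(\alpha)=1$. The ramification polynomial of $\varphi$ is $\rho(x)=\varphi(\alpha x+\alpha)/\alpha^n=\sum_{i=1}^n\rho_ix^i\in\mathcal{O}_L[x]$ and the ramification polygon of $\varphi$ is the Newton polygon of $\rho$ (lower convex hull of the points $(i,v_\alpha(\rho_i))$). It depends only on $L/K$. Segments include the horizontal one, if any. Fractions $h/e$ are in lowest terms ($e\ge1$). The residual polynomial of a segment with endpoints $(k,v_\alpha(\rho_k))$, $(k+l,v_\alpha(\rho_{k+l}))$ and slope $-h/e$ is $\underline A(x)=\sum_{j=0}^{l/e}\underline{\rho_{je+k}\alpha^{jh-v_\alpha(\rho_k)}}\,x^j\in\underline K[x]$. *)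

theory Defs
  imports "HOL-Analysis.Analysis" "HOL-Algebra.Algebraic_Closure_Type"
begin

section \<open>The field of p-adic numbers\<close>

text \<open>The value of \<^term>\<open>padic_val p q\<close> is meaningful for \<open>q \<noteq> 0\<close> only; the same convention is
  used for all valuations below, which are integer-valued functions on the nonzero elements.\<close>

definition padic_val :: "nat \<Rightarrow> rat \<Rightarrow> int" where
  "padic_val p q =
     int (multiplicity (int p) (fst (quotient_of q))) - int (multiplicity (int p) (snd (quotient_of q)))"

definition padic_close :: "nat \<Rightarrow> int \<Rightarrow> rat \<Rightarrow> rat \<Rightarrow> bool" where
  "padic_close p M x y \<longleftrightarrow> x = y \<or> M \<le> padic_val p (x - y)"

definition padic_Cauchy :: "nat \<Rightarrow> (nat \<Rightarrow> rat) \<Rightarrow> bool" where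
  "padic_Cauchy p s \<longleftrightarrow> (\<forall>M. \<exists>N. \<forall>m\<ge>N. \<forall>n\<ge>N. padic_close p M (s m) (s n))"

definition padic_null :: "nat \<Rightarrow> (nat \<Rightarrow> rat) \<Rightarrow> bool" where
  "padic_null p s \<longleftrightarrow> (\<forall>M. \<exists>N. \<forall>n\<ge>N. padic_close p M (s n) 0)"

definition padic_Cauchy_ring :: "nat \<Rightarrow> (nat \<Rightarrow> rat) ring" where
  "padic_Cauchy_ring p =
     \<lparr>carrier = {s. padic_Cauchy p s}, monoid.mult = (\<lambda>s t n. s n * t n), one = (\<lambda>n. 1),
      ring.zero = (\<lambda>n. 0), add = (\<lambda>s t n. s n + t n)\<rparr>"

text \<open>The completion of the rationals: Cauchy sequences modulo null sequences.\<close>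

definition Qp :: "nat \<Rightarrow> (nat \<Rightarrow> rat) set ring" where
  "Qp p = padic_Cauchy_ring p Quot {s. padic_null p s}"

text \<open>The p-adic valuation along a Cauchy sequence that is not a null sequence is eventually
  constant, and its eventual value depends only on the class of the sequence.\<close>

definition Qp_val :: "nat \<Rightarrow> (nat \<Rightarrow> rat) set \<Rightarrow> int" where
  "Qp_val p c = (THE m. \<forall>s\<in>c. eventually (\<lambda>n. s n \<noteq> 0 \<and> padic_val p (s n) = m) sequentially)"

definition finite_ext_of_Qp :: "nat \<Rightarrow> ((nat \<Rightarrow> rat) set \<Rightarrow> 'k::field) \<Rightarrow> bool" where
  "finite_ext_of_Qp p \<iota> \<longleftrightarrow>
     \<iota> \<in> ring_hom (Qp p) (ring_of_type_algebra :: 'k ring) \<and>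
     ring.finite_dimension (ring_of_type_algebra :: 'k ring) (\<iota> ` carrier (Qp p)) UNIV"


section \<open>Valuations and residue fields\<close>

definition normalized_valuation_on :: "'a::field set \<Rightarrow> ('a \<Rightarrow> int) \<Rightarrow> bool" where
  "normalized_valuation_on F v \<longleftrightarrow>
     (\<forall>x\<in>F - {0}. \<forall>y\<in>F - {0}. v (x * y) = v x + v y) \<and>
     (\<forall>x\<in>F - {0}. \<forall>y\<in>F - {0}. x + y \<noteq> 0 \<longrightarrow> min (v x) (v y) \<le> v (x + y)) \<and>
     (\<exists>x\<in>F - {0}. v x = 1)"

text \<open>The normalized valuation of K is the unique one that is a positive multiple of the p-adic
  valuation on the image of the p-adic numbers.\<close>

definition valuation_of_K :: "nat \<Rightarrow> ((nat \<Rightarrow> rat) set \<Rightarrow> 'k::field) \<Rightarrow> ('k \<Rightarrow> int) \<Rightarrow> bool" where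
  "valuation_of_K p \<iota> v \<longleftrightarrow> normalized_valuation_on UNIV v \<and>
     (\<exists>e>0. \<forall>c\<in>carrier (Qp p) - {\<zero>\<^bsub>Qp p\<^esub>}. v (\<iota> c) = e * Qp_val p c)"

definition val_ring :: "('k::field \<Rightarrow> int) \<Rightarrow> 'k ring" where
  "val_ring v = (ring_of_type_algebra :: 'k ring)\<lparr>carrier := {x. x = 0 \<or> 0 \<le> v x}\<rparr>"

definition uniformizer :: "('k::field \<Rightarrow> int) \<Rightarrow> 'k \<Rightarrow> bool" where
  "uniformizer v \<pi> \<longleftrightarrow> \<pi> \<noteq> 0 \<and> v \<pi> = 1"

text \<open>The type \<open>'r\<close> represents the residue field (the valuation ring modulo \<open>(\<pi>)\<close>), with
  \<open>red\<close> as the canonical projection.\<close>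

definition residue_map :: "('k::field \<Rightarrow> int) \<Rightarrow> 'k \<Rightarrow> ('k \<Rightarrow> 'r::field) \<Rightarrow> bool" where
  "residue_map v \<pi> red \<longleftrightarrow>
     red \<in> ring_hom (val_ring v) (ring_of_type_algebra :: 'r ring) \<and>
     red ` carrier (val_ring v) = UNIV \<and>
     {x \<in> carrier (val_ring v). red x = 0} = PIdl\<^bsub>val_ring v\<^esub> \<pi>"

text \<open>Eisenstein polynomials are monic.\<close>

definition eisenstein :: "('k::field \<Rightarrow> int) \<Rightarrow> 'k \<Rightarrow> 'k poly \<Rightarrow> bool" where
  "eisenstein v \<pi> f \<longleftrightarrow>
     Polynomial.degree f > 0 \<and> Polynomial.lead_coeff f = 1 \<and>
     (\<forall>i < Polynomial.degree f. Polynomial.coeff f i \<in> PIdl\<^bsub>val_ring v\<^esub> \<pi>) \<and>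
     Polynomial.coeff f 0 \<notin> PIdl\<^bsub>val_ring v\<^esub> (\<pi> ^ 2)"


section \<open>The extension generated by a root\<close>

text \<open>\<open>K[x]/(f)\<close> and isomorphisms over K\<close>

definition poly_quot :: "'k::field poly \<Rightarrow> 'k poly set ring" where
  "poly_quot f = (ring_of_type_algebra :: 'k poly ring) Quot (PIdl\<^bsub>ring_of_type_algebra\<^esub> f)"

definition poly_class :: "'k::field poly \<Rightarrow> 'k poly \<Rightarrow> 'k poly set" where
  "poly_class f g = PIdl\<^bsub>ring_of_type_algebra\<^esub> f +>\<^bsub>ring_of_type_algebra\<^esub> g"

definition poly_quot_iso_over_K :: "'k::field poly \<Rightarrow> 'k poly \<Rightarrow> bool" where
  "poly_quot_iso_over_K f g \<longleftrightarrow>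
     (\<exists>h \<in> ring_iso (poly_quot f) (poly_quot g). \<forall>c. h (poly_class f [:c:]) = poly_class g [:c:])"

definition is_root :: "'k::field poly \<Rightarrow> 'k alg_closure \<Rightarrow> bool" where
  "is_root f \<alpha> \<longleftrightarrow> poly (map_poly to_ac f) \<alpha> = 0"

text \<open>\<open>K(\<alpha>)\<close>; as \<open>\<alpha>\<close> is algebraic over K, it consists of the polynomial expressions in \<open>\<alpha>\<close>.\<close>

definition adjoin_root :: "'k::field alg_closure \<Rightarrow> 'k alg_closure set" where
  "adjoin_root \<alpha> = range (\<lambda>g :: 'k poly. poly (map_poly to_ac g) \<alpha>)"

definition valuation_of_L :: "('k::field \<Rightarrow> int) \<Rightarrow> 'k alg_closure \<Rightarrow> ('k alg_closure \<Rightarrow> int) \<Rightarrow> bool" where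
  "valuation_of_L vK \<alpha> v \<longleftrightarrow>
     normalized_valuation_on (adjoin_root \<alpha>) v \<and>
     (\<exists>e>0. \<forall>c. c \<noteq> 0 \<longrightarrow> v (to_ac c) = e * vK c) \<and>
     v \<alpha> = 1"

text \<open>The residue class of an integral element \<open>x\<close> of L. As L is totally ramified over K, its
  residue field is that of K: \<open>x\<close> is congruent to some integral \<open>c\<close> in K modulo the maximal ideal
  of the valuation ring of L.\<close>

definition residue_L ::
  "('k::field \<Rightarrow> int) \<Rightarrow> ('k \<Rightarrow> 'r::field) \<Rightarrow> ('k alg_closure \<Rightarrow> int) \<Rightarrow> 'k alg_closure \<Rightarrow> 'r" where
  "residue_L vK red v x =
     (THE r. \<exists>c \<in> carrier (val_ring vK). (x = to_ac c \<or> 0 < v (x - to_ac c)) \<and> r = red c)"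


section \<open>Ramification polygon and residual polynomials\<close>

definition ramification_poly :: "'k::field poly \<Rightarrow> 'k alg_closure \<Rightarrow> 'k alg_closure poly" where
  "ramification_poly f \<alpha> =
     Polynomial.smult (inverse (\<alpha> ^ Polynomial.degree f)) (pcompose (map_poly to_ac f) [:\<alpha>, \<alpha>:])"

definition lower_hull :: "(real \<times> real) set \<Rightarrow> (real \<times> real) set" where
  "lower_hull S = {(x, y). (x, y) \<in> convex hull S \<and> (\<forall>y'. (x, y') \<in> convex hull S \<longrightarrow> y \<le> y')}"

text \<open>Zero coefficients have infinite valuation and contribute no point.\<close>

definition newton_point :: "('a::field \<Rightarrow> int) \<Rightarrow> 'a poly \<Rightarrow> nat \<Rightarrow> real \<times> real" where
  "newton_point v \<rho> i = (real i, real_of_int (v (Polynomial.coeff \<rho> i)))"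

definition newton_polygon :: "('a::field \<Rightarrow> int) \<Rightarrow> 'a poly \<Rightarrow> (real \<times> real) set" where
  "newton_polygon v \<rho> = lower_hull (newton_point v \<rho> ` {i. Polynomial.coeff \<rho> i \<noteq> 0})"

text \<open>The segments of the polygon are the maximal nondegenerate line segments contained in it. Their
  endpoints are vertices of the convex hull, hence Newton points; the pair \<open>(k, m)\<close> encodes the
  segment from the point with abscissa \<open>k\<close> to the point with abscissa \<open>m = k + l\<close>.\<close>

definition newton_segments :: "('a::field \<Rightarrow> int) \<Rightarrow> 'a poly \<Rightarrow> (nat \<times> nat) set" where
  "newton_segments v \<rho> =
     {(k, m). k < m \<and> Polynomial.coeff \<rho> k \<noteq> 0 \<and> Polynomial.coeff \<rho> m \<noteq> 0 \<and>
        (let s = closed_segment (newton_point v \<rho> k) (newton_point v \<rho> m) in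
           s \<subseteq> newton_polygon v \<rho> \<and>
           (\<forall>a b. s \<subseteq> closed_segment a b \<and> closed_segment a b \<subseteq> newton_polygon v \<rho> \<longrightarrow>
              closed_segment a b = s))}"

definition newton_segment_list :: "('a::field \<Rightarrow> int) \<Rightarrow> 'a poly \<Rightarrow> (nat \<times> nat) list" where
  "newton_segment_list v \<rho> = sorted_key_list_of_set fst (newton_segments v \<rho>)"

text \<open>The pair \<open>(h, e)\<close> such that the segment has slope \<open>-h/e\<close>, in lowest terms with \<open>e > 0\<close>.\<close>

definition segment_slope :: "('a::field \<Rightarrow> int) \<Rightarrow> 'a poly \<Rightarrow> nat \<times> nat \<Rightarrow> int \<times> int" where
  "segment_slope v \<rho> = (\<lambda>(k, m).
     quotient_of (rat_of_int (v (Polynomial.coeff \<rho> k) - v (Polynomial.coeff \<rho> m)) / rat_of_nat (m - k)))"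

definition residual_poly ::
  "('k::field \<Rightarrow> int) \<Rightarrow> ('k \<Rightarrow> 'r::field) \<Rightarrow> ('k alg_closure \<Rightarrow> int) \<Rightarrow> 'k alg_closure \<Rightarrow>
     'k alg_closure poly \<Rightarrow> nat \<times> nat \<Rightarrow> 'r poly" where
  "residual_poly vK red v \<alpha> \<rho> = (\<lambda>(k, m).
     let h = fst (segment_slope v \<rho> (k, m)); e = nat (snd (segment_slope v \<rho> (k, m)))
     in \<Sum>j\<le>(m - k) div e.
          Polynomial.monom
            (residue_L vK red v
               (Polynomial.coeff \<rho> (j * e + k) * \<alpha> powi (int j * h - v (Polynomial.coeff \<rho> k)))) j)"


section \<open>The invariant\<close>

text \<open>Lists of pairs \<open>(h\<^sub>i, A\<^sub>i)\<close> encode the slopes and residual polynomials from left to right. On a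
  nonempty tail starting at index \<open>i\<close>, \<open>gamma \<delta>\<close> is \<open>\<gamma>\<^sub>\<delta>\<^sub>,\<^sub>i\<close>.\<close>

fun gamma :: "'r::field \<Rightarrow> (int \<times> 'r poly) list \<Rightarrow> 'r" where
  "gamma \<delta> [] = 1"
| "gamma \<delta> ((h, A) # xs) = gamma \<delta> xs * \<delta> powi (- h * int (Polynomial.degree A))"

fun twist :: "'r::field \<Rightarrow> (int \<times> 'r poly) list \<Rightarrow> 'r poly list" where
  "twist \<delta> [] = []"
| "twist \<delta> ((h, A) # xs) =
     Polynomial.smult (gamma \<delta> ((h, A) # xs)) (pcompose A [:0, \<delta> powi h:]) # twist \<delta> xs"

definition slopes_and_residual_polys ::
  "('k::field \<Rightarrow> int) \<Rightarrow> ('k \<Rightarrow> 'r::field) \<Rightarrow> 'k poly \<Rightarrow> 'k alg_closure \<Rightarrow> ('k alg_closure \<Rightarrow> int) \<Rightarrow>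
     (int \<times> 'r poly) list" where
  "slopes_and_residual_polys vK red f \<alpha> v =
     (let \<rho> = ramification_poly f \<alpha>
      in map (\<lambda>s. (fst (segment_slope v \<rho> s), residual_poly vK red v \<alpha> \<rho> s))
           (newton_segment_list v \<rho>))"

definition residual_invariant ::
  "('k::field \<Rightarrow> int) \<Rightarrow> ('k \<Rightarrow> 'r::field) \<Rightarrow> 'k poly \<Rightarrow> 'k alg_closure \<Rightarrow> ('k alg_closure \<Rightarrow> int) \<Rightarrow>
     'r poly list set" where
  "residual_invariant vK red f \<alpha> v =
     {twist \<delta> (slopes_and_residual_polys vK red f \<alpha> v) | \<delta>. \<delta> \<noteq> 0}"

end

theory Submission
  imports Defs
begin

text \<open>
  Both polynomials can be studied in one field. An isomorphism of \<open>K[x]/(\<psi>)\<close> with \<open>K[x]/(\<phi>)\<close> yields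
  a root \<open>\<alpha>'\<close> of \<open>\<phi>\<close> that generates \<open>K(\<beta>)\<close> (\<open>iso_generator\<close>). Values in \<open>K(\<alpha>)\<close> are known explicitly:
  the terms of \<open>\<Sum> c\<^sub>i \<alpha>\<^sup>i\<close> with \<open>i < n\<close> have pairwise different values (\<open>v_ev\<close>). Hence \<open>\<alpha>'\<close> is again a
  uniformizer, the valuations of \<open>K(\<alpha>)\<close> and \<open>K(\<alpha>') = K(\<beta>)\<close> correspond, and the invariants computed
  from \<open>\<alpha>\<close> and \<open>\<alpha>'\<close> are the same (\<open>residual_invariant_conj\<close>).

  It remains to compare two uniformizers \<open>\<alpha>\<close> and \<open>\<beta>\<close> of the same field \<open>L\<close>, with ramification polynomials
  \<open>\<rho>\<close> and \<open>\<rho>'\<close>. Write \<open>\<beta> = g(\<alpha>)\<close>. Then \<open>\<phi>\<close> divides \<open>\<psi> \<circ> g\<close>, so \<open>\<rho>\<close> divides \<open>\<rho>' \<circ> G\<close>, where \<open>G\<close> is \<open>g\<close>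
  in the scaled variables, \<open>g(\<alpha> + \<alpha> x) = \<beta> + \<beta> G(x)\<close>. As \<open>\<beta> / \<alpha>\<close> is a unit and the residue field does
  not grow, \<open>G = x (1 + M)\<close> with \<open>M\<close> zero modulo the maximal ideal, and comparing coefficients in
  \<open>\<rho>' \<circ> G = \<rho> Q\<close> shows that \<open>\<rho>'\<^sub>i - \<rho>\<^sub>i\<close> has larger value than one of \<open>\<rho>\<^sub>0, \<dots>, \<rho>\<^sub>i\<close>
  (\<open>perturbed_divisor_close\<close>, \<open>ramification_polys_close\<close>). The polygon is nonincreasing, so the
  coefficients differ only strictly above it. Therefore the polygons and their segments coincide
  (\<open>newton_segments_eq\<close>), and the coefficients on the polygon have the same leading terms.

  Consequently the residual polynomials differ only through the normalization by powers of \<open>\<alpha>\<close> or \<open>\<beta>\<close>: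
  with \<open>\<delta>\<close> the residue of \<open>\<beta> / \<alpha>\<close>, that of a segment starting at height \<open>y\<close> changes from \<open>A(x)\<close> to
  \<open>\<delta>\<^sup>-\<^sup>y A(\<delta>\<^sup>h x)\<close> (\<open>residual_poly_change\<close>). Since \<open>h deg A\<close> is the drop along a segment, and the segments
  tile the polygon down to height 0 (\<open>segment_list_contiguous\<close>), \<open>\<delta>\<^sup>-\<^sup>y\<close> is exactly the factor \<open>\<gamma>\<^sub>\<delta>\<^sub>,\<^sub>i\<close>
  (\<open>gamma_telescope\<close>). Passing from \<open>\<alpha>\<close> to \<open>\<beta>\<close> thus permutes the elements of the invariant.
\<close>


hide_const (open) Polynomials.degree UnivPoly.coeff UnivPoly.monom Module.smult

section \<open>Subfields with a discrete valuation\<close>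

locale valued_subfield =
  fixes F :: "'a::field set" and v :: "'a \<Rightarrow> int"
  assumes one_mem: "1 \<in> F"
    and add_mem: "\<And>x y. x \<in> F \<Longrightarrow> y \<in> F \<Longrightarrow> x + y \<in> F"
    and uminus_mem: "\<And>x. x \<in> F \<Longrightarrow> - x \<in> F"
    and mult_mem: "\<And>x y. x \<in> F \<Longrightarrow> y \<in> F \<Longrightarrow> x * y \<in> F"
    and inverse_mem: "\<And>x. x \<in> F \<Longrightarrow> inverse x \<in> F"
    and v_mult: "\<And>x y. x \<in> F \<Longrightarrow> y \<in> F \<Longrightarrow> x \<noteq> 0 \<Longrightarrow> y \<noteq> 0 \<Longrightarrow> v (x * y) = v x + v y"
    and v_add: "\<And>x y. x \<in> F \<Longrightarrow> y \<in> F \<Longrightarrow> x \<noteq> 0 \<Longrightarrow> y \<noteq> 0 \<Longrightarrow> x + y \<noteq> 0 \<Longrightarrow>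
                  min (v x) (v y) \<le> v (x + y)"
begin

lemma zero_mem: "0 \<in> F"
  using add_mem[OF one_mem uminus_mem[OF one_mem]] by simp

lemma diff_mem: "x \<in> F \<Longrightarrow> y \<in> F \<Longrightarrow> x - y \<in> F"
  using add_mem[OF _ uminus_mem, of x y] by simp

lemma power_mem: "x \<in> F \<Longrightarrow> x ^ n \<in> F"
  by (induction n) (auto intro: one_mem mult_mem)

lemma power_int_mem: "x \<in> F \<Longrightarrow> x powi n \<in> F"
  by (auto simp: power_int_def intro: power_mem inverse_mem)

lemma v_one: "v 1 = 0"
  using v_mult[of 1 1] one_mem by simp

lemma v_uminus: "x \<in> F \<Longrightarrow> v (- x) = v x"
proof (cases "x = 0")
  case False
  assume "x \<in> F"
  have "v (- 1) = 0"
    using v_mult[of "- 1" "- 1"] uminus_mem[OF one_mem] v_one by simp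
  then show ?thesis
    using v_mult[of "- 1" x] uminus_mem[OF one_mem] False \<open>x \<in> F\<close> by simp
qed simp

lemma v_inverse: "x \<in> F \<Longrightarrow> x \<noteq> 0 \<Longrightarrow> v (inverse x) = - v x"
  using v_mult[of x "inverse x"] v_one inverse_mem by simp

lemma v_power: "x \<in> F \<Longrightarrow> x \<noteq> 0 \<Longrightarrow> v (x ^ n) = int n * v x"
  by (induction n) (auto simp: v_one v_mult power_mem algebra_simps)

lemma v_power_int: "x \<in> F \<Longrightarrow> x \<noteq> 0 \<Longrightarrow> v (x powi n) = n * v x"
  by (auto simp: power_int_def v_power inverse_mem v_inverse)

text \<open>As \<open>v\<close> says nothing about \<open>0\<close>, estimates from below are expressed by membership in the
  fractional ideals of the valuation ring.\<close>

definition fid :: "int \<Rightarrow> 'a set" where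
  "fid t = {x \<in> F. x = 0 \<or> t \<le> v x}"

lemma fid_mem: "x \<in> fid t \<Longrightarrow> x \<in> F"
  by (simp add: fid_def)

lemma fid_zero [simp]: "0 \<in> fid t"
  by (simp add: fid_def zero_mem)

lemma fid_one [simp]: "1 \<in> fid 0"
  by (simp add: fid_def one_mem v_one)

lemma fid_mono: "x \<in> fid t \<Longrightarrow> s \<le> t \<Longrightarrow> x \<in> fid s"
  by (auto simp: fid_def)

lemma fid_add: "x \<in> fid t \<Longrightarrow> y \<in> fid t \<Longrightarrow> x + y \<in> fid t"
  using v_add[of x y] by (cases "x = 0 \<or> y = 0 \<or> x + y = 0") (auto simp: fid_def add_mem zero_mem)

lemma fid_uminus: "x \<in> fid t \<Longrightarrow> - x \<in> fid t"
  by (auto simp: fid_def uminus_mem v_uminus)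

lemma fid_diff: "x \<in> fid t \<Longrightarrow> y \<in> fid t \<Longrightarrow> x - y \<in> fid t"
  using fid_add[OF _ fid_uminus, of x t y] by simp

lemma fid_mult: "x \<in> fid s \<Longrightarrow> y \<in> fid t \<Longrightarrow> x * y \<in> fid (s + t)"
  by (cases "x = 0 \<or> y = 0") (auto simp: fid_def mult_mem v_mult zero_mem)

lemma fid_sum: "(\<And>i. i \<in> I \<Longrightarrow> f i \<in> fid t) \<Longrightarrow> (\<Sum>i\<in>I. f i) \<in> fid t"
  by (induction I rule: infinite_finite_induct) (auto intro: fid_add)

lemma fid_iff: "x \<in> F \<Longrightarrow> x \<noteq> 0 \<Longrightarrow> x \<in> fid t \<longleftrightarrow> t \<le> v x"
  by (simp add: fid_def)

lemma v_cong_dominant: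
  assumes "x \<in> F" "x \<noteq> 0" "y - x \<in> fid (v x + 1)"
  shows "y \<in> F" "y \<noteq> 0" "v y = v x"
proof -
  have "y = (y - x) + x" by simp
  then show F: "y \<in> F" using add_mem[OF fid_mem[OF assms(3)] assms(1)] by simp
  show nz: "y \<noteq> 0"
    using assms fid_iff[OF uminus_mem, of x "v x + 1"] v_uminus by auto
  have "y \<in> fid (v x)"
    using fid_add[OF fid_mono[OF assms(3)], of "v x" x] assms(1,2) by (simp add: fid_def)
  then have "v x \<le> v y" using nz by (simp add: fid_def)
  moreover have "\<not> v x + 1 \<le> v y"
  proof
    assume "v x + 1 \<le> v y"
    then have "y \<in> fid (v x + 1)" using F by (simp add: fid_def)
    then have "x \<in> fid (v x + 1)" using fid_diff[OF _ assms(3), of y] by simp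
    then show False using assms(2) by (simp add: fid_def)
  qed
  ultimately show "v y = v x" by simp
qed

text \<open>A sum of terms with pairwise different values cannot have cancellation in its least value.\<close>

lemma v_sum_distinct:
  assumes "finite I" "I \<noteq> {}" "\<And>i. i \<in> I \<Longrightarrow> f i \<in> F" "\<And>i. i \<in> I \<Longrightarrow> f i \<noteq> 0"
    and "inj_on (\<lambda>i. v (f i)) I"
  shows "(\<Sum>i\<in>I. f i) \<noteq> 0 \<and> (\<exists>i\<in>I. v (\<Sum>i\<in>I. f i) = v (f i) \<and> (\<forall>j\<in>I. v (f i) \<le> v (f j)))"
  using assms
proof (induction I rule: finite_ne_induct)
  case (insert a I)
  let ?s = "\<Sum>i\<in>I. f i"
  have sF: "?s \<in> F"
    using insert.prems(1) zero_mem by (intro fid_mem[OF fid_sum[of _ _ "Min ((\<lambda>i. v (f i)) ` I)"]])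
      (auto simp: fid_def insert.hyps)
  obtain i where i: "i \<in> I" "?s \<noteq> 0" "v ?s = v (f i)" "\<forall>j\<in>I. v (f i) \<le> v (f j)"
    using insert by (auto simp: inj_on_insert)
  have a: "f a \<in> F" "f a \<noteq> 0" using insert.prems by auto
  have ne: "v (f a) \<noteq> v (f i)" using insert.prems(3) insert.hyps i(1) by (auto simp: inj_on_def)
  show ?case
  proof (cases "v (f a) < v (f i)")
    case True
    have "(f a + ?s) - f a \<in> fid (v (f a) + 1)"
      using True i sF by (simp add: fid_def)
    from v_cong_dominant[OF a this] show ?thesis
      using insert.hyps True i by (fastforce intro!: bexI[of _ a])
  next
    case False
    have "(f a + ?s) - ?s \<in> fid (v ?s + 1)"
      using False ne i a by (simp add: fid_def)
    from v_cong_dominant[OF sF i(2) this] show ?thesis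
      using insert.hyps False ne i by (fastforce intro!: bexI[of _ i])
  qed
qed auto

definition pfid :: "int \<Rightarrow> 'a poly \<Rightarrow> bool" where
  "pfid t f \<longleftrightarrow> (\<forall>i. coeff f i \<in> fid t)"

lemma pfid_pCons: "a \<in> fid t \<Longrightarrow> pfid t f \<Longrightarrow> pfid t (pCons a f)"
  by (simp add: pfid_def coeff_pCons split: nat.split)

lemma pfid_zero [simp]: "pfid t 0"
  by (simp add: pfid_def)

lemma pfid_add: "pfid t f \<Longrightarrow> pfid t g \<Longrightarrow> pfid t (f + g)"
  by (simp add: pfid_def fid_add)

lemma pfid_smult: "a \<in> fid s \<Longrightarrow> pfid t f \<Longrightarrow> pfid (s + t) (smult a f)"
  by (simp add: pfid_def fid_mult)

lemma pfid_mult: "pfid s f \<Longrightarrow> pfid t g \<Longrightarrow> pfid (s + t) (f * g)"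
  by (auto simp: pfid_def coeff_mult intro!: fid_sum fid_mult)

lemma pfid_pcompose: "pfid t f \<Longrightarrow> pfid 0 g \<Longrightarrow> pfid t (pcompose f g)"
proof (induction f)
  case (pCons a f)
  have "a \<in> fid t" "pfid t f"
    using pCons.prems(1) by (auto simp: pfid_def dest: spec[of _ 0] spec[of _ "Suc _"])
  then have "pfid t ([:a:] + g * pcompose f g)"
    using pfid_mult[of 0 g t "pcompose f g"] pCons by (intro pfid_add pfid_pCons) auto
  then show ?case by (simp add: pcompose_pCons)
qed simp

text \<open>The value of a Taylor expansion at \<open>a\<close> in the scaled variable \<open>a x\<close> is governed by the terms
  \<open>f\<^sub>i a\<^sup>i\<close> alone, since \<open>f(a + a x)\<close> is obtained from \<open>\<Sum> f\<^sub>i a\<^sup>i x\<^sup>i\<close> by the integral substitution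
  \<open>x \<mapsto> 1 + x\<close>.\<close>

lemma pfid_taylor:
  assumes "\<And>i. coeff f i * a ^ i \<in> fid t"
  shows "pfid t (pcompose f [:a, a:])"
proof -
  have "pcompose (pcompose f [:0, a:]) [:1, 1:] = pcompose f [:a, a:]"
    by (simp add: pcompose_assoc[symmetric] pcompose_pCons)
  moreover have "pfid t (pcompose f [:0, a:])"
    using assms by (simp add: pfid_def coeff_pcompose_linear mult.commute)
  moreover have "pfid 0 [:1, 1:]"
    by (intro pfid_pCons) auto
  ultimately show ?thesis
    using pfid_pcompose[of t "pcompose f [:0, a:]" "[:1, 1:]"] by simp
qed

section \<open>Perturbing a polynomial by a substitution\<close>

lemma coeff_mult_one_plus:
  assumes M: "pfid 1 M" and p: "\<And>j. j \<le> i \<Longrightarrow> coeff p j \<in> fid t"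
  shows "coeff (p * (1 + M)) i - coeff p i \<in> fid (t + 1)"
proof -
  have "coeff (p * (1 + M)) i - coeff p i = (\<Sum>j\<le>i. coeff p j * coeff M (i - j))"
    by (simp add: distrib_left coeff_mult)
  also have "\<dots> \<in> fid (t + 1)"
    using M p by (intro fid_sum fid_mult) (auto simp: pfid_def)
  finally show ?thesis .
qed

text \<open>In \<open>\<Sum> p\<^sub>j x\<^sup>j (1 + M)\<^sup>j\<close> only the terms with \<open>j \<le> i\<close> reach the coefficient at \<open>i\<close>, and all of
  them except \<open>p\<^sub>i\<close> itself pick up a coefficient of \<open>M\<close>, which gains one unit of value.\<close>

lemma coeff_pcompose_perturb:
  assumes M: "pfid 1 M" and p: "\<And>j. j \<le> i \<Longrightarrow> coeff p j \<in> fid t"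
  shows "coeff (pcompose p (pCons 0 (1 + M))) i - coeff p i \<in> fid (t + 1)"
  using p
proof (induction p arbitrary: i)
  case (pCons a p)
  let ?c = "pcompose p (pCons 0 (1 + M))"
  have eq: "pcompose (pCons a p) (pCons 0 (1 + M)) = pCons a (?c * (1 + M))"
    by (simp add: pcompose_pCons mult.commute)
  show ?case
  proof (cases i)
    case (Suc k)
    have p: "coeff p j \<in> fid t" if "j \<le> k" for j
      using pCons.prems[of "Suc j"] that Suc by simp
    have IH: "coeff ?c j - coeff p j \<in> fid (t + 1)" if "j \<le> k" for j
      using that by (intro pCons.IH p) auto
    have "coeff ?c j \<in> fid t" if "j \<le> k" for j
      using fid_add[OF fid_mono[OF IH[OF that], of t] p[OF that]] by simp
    then have "coeff (?c * (1 + M)) k - coeff ?c k \<in> fid (t + 1)"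
      by (intro coeff_mult_one_plus M)
    from fid_add[OF this IH[of k]] show ?thesis
      unfolding eq using Suc by simp
  qed (simp add: eq)
qed simp

text \<open>The difference of the coefficients at \<open>i\<close> has strictly larger value than the least value among
  the coefficients of \<open>f\<close> up to \<open>i\<close>. Quantifying over the bounds \<open>t\<close> replaces the minimum, which
  is infinite when all these coefficients vanish; in that case \<open>g\<close> vanishes there too.\<close>

definition envelope_close :: "'a poly \<Rightarrow> 'a poly \<Rightarrow> bool" where
  "envelope_close f g \<longleftrightarrow>
     (\<forall>t i. (\<forall>j\<le>i. coeff f j \<in> fid t) \<longrightarrow> coeff g i - coeff f i \<in> fid (t + 1))"

lemma envelope_closeD:
  "envelope_close f g \<Longrightarrow> (\<And>j. j \<le> i \<Longrightarrow> coeff f j \<in> fid t) \<Longrightarrow> coeff g i - coeff f i \<in> fid (t + 1)"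
  by (auto simp: envelope_close_def)

text \<open>It suffices to know the estimate under a bound for both polynomials.\<close>

lemma envelope_closeI:
  assumes f: "pfid 0 f" and g: "pfid 0 g"
    and *: "\<And>t i. (\<And>j. j \<le> i \<Longrightarrow> coeff f j \<in> fid t) \<Longrightarrow> (\<And>j. j \<le> i \<Longrightarrow> coeff g j \<in> fid t) \<Longrightarrow>
              coeff g i - coeff f i \<in> fid (t + 1)"
  shows "envelope_close f g"
  unfolding envelope_close_def
proof (intro allI impI)
  fix t i
  assume t: "\<forall>j\<le>i. coeff f j \<in> fid t"
  \<comment> \<open>the bound passes from \<open>f\<close> to \<open>g\<close> one unit at a time, starting from integrality\<close>
  have g': "coeff g j \<in> fid (min (int s) t)" if "j \<le> i" for s j
    using that
  proof (induction s arbitrary: j)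
    case 0
    then show ?case using g by (auto simp: pfid_def intro: fid_mono)
  next
    case (Suc s)
    have "coeff g j - coeff f j \<in> fid (min (int s) t + 1)"
    proof (rule *)
      fix k assume "k \<le> j"
      then show "coeff f k \<in> fid (min (int s) t)"
        using t Suc.prems by (auto intro: fid_mono[of _ t])
      show "coeff g k \<in> fid (min (int s) t)" using Suc \<open>k \<le> j\<close> by auto
    qed
    then have "coeff g j - coeff f j \<in> fid (min (int (Suc s)) t)"
      by (rule fid_mono) auto
    moreover have "coeff f j \<in> fid (min (int (Suc s)) t)"
      using t Suc.prems by (auto intro: fid_mono[of _ t])
    ultimately show ?case using fid_add by fastforce
  qed
  have "coeff g j \<in> fid t" if "j \<le> i" for j
    using g'[OF that, of "nat t"] by (rule fid_mono) auto
  then show "coeff g i - coeff f i \<in> fid (t + 1)"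
    using t by (intro *) auto
qed

text \<open>Suppose that the substitution \<open>x \<mapsto> x (1 + M)\<close>, which is trivial modulo the maximal ideal, makes
  \<open>\<rho>'\<close> divisible by \<open>\<rho>\<close>. The cofactor \<open>Q\<close> is 1 modulo the maximal ideal, so comparing
  coefficients in \<open>\<rho>'(x (1 + M)) = \<rho> Q\<close> at \<open>i\<close> leaves \<open>\<rho>'\<^sub>i - \<rho>\<^sub>i\<close> plus products of lower coefficients
  with elements of the maximal ideal. This replaces the usual comparison of the roots of
  \<open>\<rho>\<close> and \<open>\<rho>'\<close> in a splitting field, and with it the extension of the valuation.\<close>

lemma perturbed_divisor_close:
  assumes \<rho>: "pfid 0 \<rho>" "coeff \<rho> n = 1" "degree \<rho> \<le> n"
    and \<rho>': "pfid 0 \<rho>'" "coeff \<rho>' n = 1" "degree \<rho>' \<le> n"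
    and M: "pfid 1 M"
    and eq: "pcompose \<rho>' (pCons 0 (1 + M)) = \<rho> * Q"
  shows "envelope_close \<rho> \<rho>'" "envelope_close \<rho>' \<rho>"
proof -
  have F: "coeff (\<rho> * Q) i - coeff \<rho>' i \<in> fid 1" for i
    unfolding eq[symmetric] using coeff_pcompose_perturb[OF M, of i \<rho>' 0] \<rho>'(1) by (simp add: pfid_def)
  have split: "coeff (\<rho> * Q) (n + k) = coeff Q k + (\<Sum>j\<in>{k<..n + k}. coeff Q j * coeff \<rho> (n + k - j))" for k
  proof -
    have "coeff (\<rho> * Q) (n + k) = (\<Sum>j\<le>n + k. coeff Q j * coeff \<rho> (n + k - j))"
      by (simp add: coeff_mult mult.commute[of \<rho>])
    also have "{..n + k} = {..<k} \<union> ({k} \<union> {k<..n + k})" by auto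
    also have "(\<Sum>j\<in>\<dots>. coeff Q j * coeff \<rho> (n + k - j)) =
      (\<Sum>j<k. coeff Q j * coeff \<rho> (n + k - j)) +
      (coeff Q k * coeff \<rho> n + (\<Sum>j\<in>{k<..n + k}. coeff Q j * coeff \<rho> (n + k - j)))"
      by (subst sum.union_disjoint, auto)+
    also have "(\<Sum>j<k. coeff Q j * coeff \<rho> (n + k - j)) = 0"
      using \<rho>(3) by (intro sum.neutral) (auto intro: coeff_eq_0)
    finally show ?thesis using \<rho>(2) by simp
  qed
  \<comment> \<open>modulo the maximal ideal, \<open>\<rho>'\<close> is \<open>\<rho> Q\<close>; both are monic of degree \<open>n\<close>, so \<open>Q\<close> is 1 there\<close>
  have Qpos: "coeff Q k \<in> fid 1" if "k > 0" for k
    using that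
  proof (induction "degree Q - k" arbitrary: k rule: less_induct)
    case less
    show ?case
    proof (cases "k > degree Q")
      case False
      have "coeff Q j * coeff \<rho> (n + k - j) \<in> fid 1" if "k < j" for j
      proof -
        have "coeff Q j \<in> fid 1"
        proof (cases "j \<le> degree Q")
          case True
          then show ?thesis using less.hyps[of j] less.prems that False by auto
        qed (simp add: coeff_eq_0)
        from fid_mult[OF this, of "coeff \<rho> (n + k - j)" 0] show ?thesis
          using \<rho>(1) by (simp add: pfid_def)
      qed
      then have "(\<Sum>j\<in>{k<..n + k}. coeff Q j * coeff \<rho> (n + k - j)) \<in> fid 1"
        by (intro fid_sum) auto
      moreover have "coeff (\<rho> * Q) (n + k) \<in> fid 1"
        using F[of "n + k"] \<rho>'(3) less.prems by (simp add: coeff_eq_0)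
      ultimately show ?thesis using split[of k] fid_diff by fastforce
    qed (simp add: coeff_eq_0)
  qed
  have "(\<Sum>j\<in>{0<..n + 0}. coeff Q j * coeff \<rho> (n + 0 - j)) \<in> fid 1"
    using Qpos \<rho>(1) by (intro fid_sum fid_mult[of _ 1 _ 0, simplified]) (auto simp: pfid_def)
  moreover have "coeff (\<rho> * Q) n - 1 \<in> fid 1" using F[of n] \<rho>'(2) by simp
  ultimately have Q0: "coeff Q 0 - 1 \<in> fid 1"
    using split[of 0] fid_diff by (fastforce simp: algebra_simps)
  have Q: "pfid 1 (Q - 1)"
    unfolding pfid_def
  proof
    fix i show "coeff (Q - 1) i \<in> fid 1"
      using Q0 Qpos[of i] by (cases i) auto
  qed
  have *: "coeff \<rho>' i - coeff \<rho> i \<in> fid (t + 1)"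
    if "\<And>j. j \<le> i \<Longrightarrow> coeff \<rho> j \<in> fid t" "\<And>j. j \<le> i \<Longrightarrow> coeff \<rho>' j \<in> fid t" for i t
  proof -
    have "coeff (\<rho> * Q) i - coeff \<rho> i \<in> fid (t + 1)"
      using coeff_mult_one_plus[OF Q, of i \<rho> t] that(1) by simp
    moreover have "coeff (\<rho> * Q) i - coeff \<rho>' i \<in> fid (t + 1)"
      using coeff_pcompose_perturb[OF M, of i \<rho>' t] that(2) by (simp add: eq)
    ultimately show ?thesis using fid_diff by fastforce
  qed
  show "envelope_close \<rho> \<rho>'"
    using \<rho>(1) \<rho>'(1) * by (rule envelope_closeI)
  show "envelope_close \<rho>' \<rho>"
    using \<rho>'(1) \<rho>(1)
  proof (rule envelope_closeI)
    fix t i assume "\<And>j. j \<le> i \<Longrightarrow> coeff \<rho>' j \<in> fid t" "\<And>j. j \<le> i \<Longrightarrow> coeff \<rho> j \<in> fid t"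
    then show "coeff \<rho> i - coeff \<rho>' i \<in> fid (t + 1)"
      using fid_uminus[OF *[of i t]] by simp
  qed
qed

end

section \<open>Adjoining a root of an Eisenstein polynomial\<close>

abbreviation up :: "'k::field poly \<Rightarrow> 'k alg_closure poly" where
  "up \<equiv> map_poly to_ac"

abbreviation ev :: "'k::field poly \<Rightarrow> 'k alg_closure \<Rightarrow> 'k alg_closure" where
  "ev f x \<equiv> poly (up f) x"

lemma up_pCons [simp]: "up (pCons c f) = pCons (to_ac c) (up f)"
  by (simp add: map_poly_pCons)

lemma up_one [simp]: "up 1 = 1"
  by (simp add: one_pCons)

lemma up_add [simp]: "up (f + g) = up f + up g"
  by (rule poly_eqI) (simp add: coeff_map_poly)

lemma up_diff [simp]: "up (f - g) = up f - up g"
  by (rule poly_eqI) (simp add: coeff_map_poly)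

lemma up_smult [simp]: "up (smult c f) = smult (to_ac c) (up f)"
  by (rule poly_eqI) (simp add: coeff_map_poly)

lemma up_mult [simp]: "up (f * g) = up f * up g"
  by (rule poly_eqI) (simp add: coeff_map_poly coeff_mult to_ac_sum)

lemma up_pcompose [simp]: "up (pcompose f g) = pcompose (up f) (up g)"
  by (induction f) (simp_all add: pcompose_pCons)

lemma coeff_up [simp]: "coeff (up f) i = to_ac (coeff f i)"
  by (simp add: coeff_map_poly)

lemma degree_up [simp]: "degree (up f) = degree f"
  by (rule degree_map_poly) simp

text \<open>Dividing a relation \<open>p(y) = 0\<close> by its constant term exhibits the inverse of \<open>y\<close> as a polynomial
  in \<open>y\<close>; this makes \<open>K(\<alpha>)\<close> a field.\<close>

lemma inverse_eq_ev: "\<exists>q. inverse y = ev q (y :: 'k::field alg_closure)"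
proof (cases "y = 0")
  case True
  then show ?thesis by (intro exI[of _ 0]) simp
next
  case False
  obtain p where "p \<noteq> 0" "ev p y = 0" using alg_closure_algebraic .
  then show ?thesis
  proof (induction p)
    case (pCons c p)
    show ?case
    proof (cases "c = 0")
      case True
      then show ?thesis using pCons False by auto
    next
      case nz: False
      have "y * ev p y = - to_ac c"
        using pCons.prems(2) by (simp add: add_eq_0_iff)
      then have "to_ac (- inverse c) * (y * ev p y) = 1" using nz by simp
      then have "y * ev (smult (- inverse c) p) y = 1"
        by (simp add: mult.left_commute del: smult_minus_left)
      then show ?thesis using inverse_unique by blast
    qed
  qed simp
qed

lemma adjoin_rootI [intro]: "ev f \<alpha> \<in> adjoin_root \<alpha>"
  by (simp add: adjoin_root_def)

lemma adjoin_rootE: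
  assumes "x \<in> adjoin_root \<alpha>" obtains f where "x = ev f \<alpha>"
  using assms by (auto simp: adjoin_root_def)

lemma adjoin_root_ev: "x \<in> adjoin_root \<alpha> \<Longrightarrow> ev f x \<in> adjoin_root \<alpha>"
  by (elim adjoin_rootE) (metis adjoin_rootI poly_pcompose up_pcompose)

lemma adjoin_root_self: "\<alpha> \<in> adjoin_root \<alpha>"
  using adjoin_rootI[of "[:0, 1:]" \<alpha>] by simp

lemma valued_subfield_adjoin_root:
  assumes "normalized_valuation_on (adjoin_root \<alpha>) v"
  shows "valued_subfield (adjoin_root \<alpha>) v"
proof
  show "1 \<in> adjoin_root \<alpha>" using adjoin_rootI[of 1] by simp
  fix x y assume x: "x \<in> adjoin_root \<alpha>"
  obtain q where "inverse x = ev q x" using inverse_eq_ev by blast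
  then show "inverse x \<in> adjoin_root \<alpha>" using adjoin_root_ev[OF x] by simp
  show "- x \<in> adjoin_root \<alpha>" using adjoin_root_ev[OF x, of "[:0, - 1:]"] by simp
  assume y: "y \<in> adjoin_root \<alpha>"
  obtain f g where fg: "x = ev f \<alpha>" "y = ev g \<alpha>" using x y by (metis adjoin_rootE)
  show "x + y \<in> adjoin_root \<alpha>" using adjoin_rootI[of "f + g" \<alpha>] fg by simp
  show "x * y \<in> adjoin_root \<alpha>" using adjoin_rootI[of "f * g" \<alpha>] fg by simp
  show "v (x * y) = v x + v y" if "x \<noteq> 0" "y \<noteq> 0"
    using that x y assms unfolding normalized_valuation_on_def by blast
  show "min (v x) (v y) \<le> v (x + y)" if "x \<noteq> 0" "y \<noteq> 0" "x + y \<noteq> 0"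
    using that x y assms unfolding normalized_valuation_on_def by blast
qed

definition eisenstein_coeffs :: "('k::field \<Rightarrow> int) \<Rightarrow> 'k poly \<Rightarrow> bool" where
  "eisenstein_coeffs v f \<longleftrightarrow> degree f > 0 \<and> Polynomial.lead_coeff f = 1 \<and>
     (\<forall>i<degree f. coeff f i = 0 \<or> 1 \<le> v (coeff f i)) \<and> coeff f 0 \<noteq> 0 \<and> v (coeff f 0) = 1"

lemma valued_subfield_UNIV:
  "normalized_valuation_on UNIV v \<Longrightarrow> valued_subfield UNIV v"
  by unfold_locales (auto simp: normalized_valuation_on_def)

lemma mem_PIdl_iff:
  fixes v :: "'k::field \<Rightarrow> int"
  assumes "normalized_valuation_on UNIV v" "a \<noteq> 0"
  shows "x \<in> PIdl\<^bsub>val_ring v\<^esub> a \<longleftrightarrow> x = 0 \<or> v a \<le> v x"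
proof -
  interpret valued_subfield UNIV v using assms(1) by (rule valued_subfield_UNIV)
  have "x \<in> PIdl\<^bsub>val_ring v\<^esub> a \<longleftrightarrow> (\<exists>y. (y = 0 \<or> 0 \<le> v y) \<and> x = y * a)"
    by (auto simp: cgenideal_def val_ring_def ring_of_type_algebra_def)
  also have "\<dots> \<longleftrightarrow> x = 0 \<or> v a \<le> v x"
  proof safe
    fix y assume "0 \<le> v y" "\<not> v a \<le> v (y * a)"
    then show "y * a = 0" using v_mult[of y a] assms(2) by auto
  next
    assume "v a \<le> v x"
    then show "\<exists>y. (y = 0 \<or> 0 \<le> v y) \<and> x = y * a"
      using v_mult[of "x / a" a] assms(2) by (intro exI[of _ "x / a"]) (cases "x = 0", auto)
  qed (auto intro!: exI[of _ 0])
  finally show ?thesis .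
qed

lemma eisenstein_imp_coeffs:
  assumes v: "normalized_valuation_on UNIV v" and \<pi>: "uniformizer v \<pi>" and f: "eisenstein v \<pi> f"
  shows "eisenstein_coeffs v f"
proof -
  interpret valued_subfield UNIV v using v by (rule valued_subfield_UNIV)
  have \<pi>': "\<pi> \<noteq> 0" "v \<pi> = 1" "v (\<pi> ^ 2) = 2"
    using \<pi> v_power[of \<pi> 2] by (auto simp: uniformizer_def)
  have "coeff f 0 = 0 \<or> 1 \<le> v (coeff f 0)" "\<not> (coeff f 0 = 0 \<or> 2 \<le> v (coeff f 0))"
    using f \<pi>' mem_PIdl_iff[OF v, of \<pi>] mem_PIdl_iff[OF v, of "\<pi> ^ 2"]
    unfolding eisenstein_def by auto
  then show ?thesis
    using f \<pi>' mem_PIdl_iff[OF v, of \<pi>] by (auto simp: eisenstein_def eisenstein_coeffs_def)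
qed

locale valued_extension = valued_subfield F v
  for F :: "'k::field alg_closure set" and v :: "'k alg_closure \<Rightarrow> int" +
  fixes vK :: "'k \<Rightarrow> int" and e :: int
  assumes base_mem: "to_ac c \<in> F"
    and v_base: "c \<noteq> 0 \<Longrightarrow> v (to_ac c) = e * vK c"
    and e_pos: "e > 0"
begin

lemma base_fid: "c = 0 \<or> s \<le> vK c \<Longrightarrow> to_ac c \<in> fid (e * s)"
  using e_pos by (cases "c = 0") (auto simp: fid_def base_mem v_base zero_mem)

lemma power_fid: "x \<in> F \<Longrightarrow> x \<noteq> 0 \<Longrightarrow> x ^ i \<in> fid (int i * v x)"
  by (simp add: fid_def power_mem v_power)

end

locale eisenstein_root = valued_extension F v vK e
  for F :: "'k::field alg_closure set" and v vK e +
  fixes \<phi> :: "'k poly" and \<alpha> :: "'k alg_closure"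
  assumes eis: "eisenstein_coeffs vK \<phi>" and root: "ev \<phi> \<alpha> = 0" and root_mem: "\<alpha> \<in> F"
begin

abbreviation n :: nat where "n \<equiv> degree \<phi>"

lemma n_pos: "n > 0" and monic: "coeff \<phi> n = 1"
  and low_coeffs: "i < n \<Longrightarrow> coeff \<phi> i = 0 \<or> 1 \<le> vK (coeff \<phi> i)"
  and const_coeff: "coeff \<phi> 0 \<noteq> 0" "vK (coeff \<phi> 0) = 1"
  using eis by (auto simp: eisenstein_coeffs_def)

lemma root_nonzero: "\<alpha> \<noteq> 0"
  using root const_coeff by (auto simp: poly_0_coeff_0)

text \<open>In the equation of \<open>\<alpha>\<close> the leading and the constant term have to balance, because every other
  term has larger value than the constant one.\<close>

lemma ramification_index: "int n * v \<alpha> = e"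
proof -
  let ?t = "\<lambda>i. to_ac (coeff \<phi> i) * \<alpha> ^ i"
  have t: "?t i \<in> fid (e + int i * v \<alpha>)" if "i < n" for i
    using fid_mult[OF base_fid[OF low_coeffs[OF that]] power_fid[OF root_mem root_nonzero]] by simp
  have sum: "\<alpha> ^ n + (\<Sum>i<n. ?t i) = 0"
    using root monic n_pos
    by (simp add: poly_altdef lessThan_Suc_atMost[symmetric] add.commute)
  have vpow: "v (\<alpha> ^ n) = int n * v \<alpha>" "\<alpha> ^ n \<in> F" "\<alpha> ^ n \<noteq> 0"
    using root_mem root_nonzero by (auto simp: v_power power_mem)
  have pos: "v \<alpha> > 0"
  proof (rule ccontr)
    assume neg: "\<not> v \<alpha> > 0"
    have "?t i \<in> fid (int n * v \<alpha> + 1)" if "i < n" for i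
    proof (rule fid_mono[OF t[OF that]])
      have "int n * v \<alpha> \<le> int i * v \<alpha>" using that neg by (intro mult_right_mono_neg) auto
      then show "int n * v \<alpha> + 1 \<le> e + int i * v \<alpha>" using e_pos by simp
    qed
    then have "(\<Sum>i<n. ?t i) \<in> fid (int n * v \<alpha> + 1)" by (intro fid_sum) auto
    moreover have "\<alpha> ^ n = - (\<Sum>i<n. ?t i)" using sum by (simp add: eq_neg_iff_add_eq_0)
    ultimately have "\<alpha> ^ n \<in> fid (int n * v \<alpha> + 1)" using fid_uminus by metis
    then show False using vpow by (simp add: fid_iff)
  qed
  have c0: "v (to_ac (coeff \<phi> 0)) = e" using const_coeff by (simp add: v_base)
  have "{..<n} = insert 0 {0<..<n}" using n_pos by auto
  then have "\<alpha> ^ n + (to_ac (coeff \<phi> 0) + (\<Sum>i\<in>{0<..<n}. ?t i)) = 0"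
    using sum by simp
  then have "- (\<alpha> ^ n) - to_ac (coeff \<phi> 0) = (\<Sum>i\<in>{0<..<n}. ?t i)"
    by (drule_tac f = "\<lambda>z. z - \<alpha> ^ n - to_ac (coeff \<phi> 0)" in arg_cong) simp
  also have "\<dots> \<in> fid (e + 1)"
  proof (rule fid_sum)
    fix i assume i: "i \<in> {0<..<n}"
    then have "1 \<le> int i * v \<alpha>" using pos by (simp add: int_one_le_iff_zero_less)
    then show "?t i \<in> fid (e + 1)" using i by (intro fid_mono[OF t]) auto
  qed
  finally have "v (- (\<alpha> ^ n)) = e"
    using v_cong_dominant(3)[of "to_ac (coeff \<phi> 0)"] base_mem const_coeff c0 by simp
  then show ?thesis using vpow by (simp add: v_uminus)
qed

lemma v_root_pos: "v \<alpha> > 0"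
  using ramification_index e_pos n_pos by (metis of_nat_0_less_iff zero_less_mult_pos)

definition term_val :: "'k poly \<Rightarrow> nat \<Rightarrow> int" where
  "term_val f i = int n * vK (coeff f i) + int i"

text \<open>The terms of \<open>f(\<alpha>)\<close> have pairwise different values, because their exponents
  are incongruent modulo \<open>n\<close>. So the valuation on \<open>K(\<alpha>)\<close> is known explicitly, which
  shows both its uniqueness and the irreducibility of \<open>\<phi>\<close>.\<close>

lemma v_ev:
  assumes f: "f \<noteq> 0" "degree f < n"
  shows "ev f \<alpha> \<noteq> 0" "v (ev f \<alpha>) = v \<alpha> * Min (term_val f ` {i. coeff f i \<noteq> 0})"
proof -
  let ?I = "{i. coeff f i \<noteq> 0}" and ?t = "\<lambda>i. to_ac (coeff f i) * \<alpha> ^ i"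
  have I: "?I \<subseteq> {..degree f}" by (auto intro: le_degree)
  then have fin: "finite ?I" by (rule finite_subset) simp
  have ne: "?I \<noteq> {}" using f(1) by (auto simp: poly_eq_iff)
  have t: "?t i \<in> F" "?t i \<noteq> 0" "v (?t i) = v \<alpha> * term_val f i" if "i \<in> ?I" for i
    using that root_mem root_nonzero
    by (auto simp: mult_mem base_mem power_mem v_mult v_power v_base term_val_def
        ramification_index[symmetric] algebra_simps)
  have inj: "inj_on (\<lambda>i. v (?t i)) ?I"
  proof (rule inj_onI)
    fix i j assume ij: "i \<in> ?I" "j \<in> ?I" "v (?t i) = v (?t j)"
    then have "term_val f i = term_val f j" using t(3) v_root_pos by simp
    then have "term_val f i mod int n = term_val f j mod int n" by simp
    moreover have "i < n" "j < n" using ij(1,2) I f(2) by auto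
    ultimately show "i = j" by (simp add: term_val_def)
  qed
  have "ev f \<alpha> = (\<Sum>i\<le>degree f. ?t i)" by (simp add: poly_altdef)
  also have "\<dots> = (\<Sum>i\<in>?I. ?t i)"
    using I by (intro sum.mono_neutral_right) auto
  finally have s: "ev f \<alpha> = (\<Sum>i\<in>?I. ?t i)" .
  from v_sum_distinct[OF fin ne t(1,2) inj] obtain i where
    i: "ev f \<alpha> \<noteq> 0" "i \<in> ?I" "v (ev f \<alpha>) = v (?t i)" "\<forall>j\<in>?I. v (?t i) \<le> v (?t j)"
    unfolding s by blast
  show "ev f \<alpha> \<noteq> 0" by fact
  have "Min (term_val f ` ?I) = term_val f i"
    using i t(3) v_root_pos fin by (intro Min_eqI) auto
  then show "v (ev f \<alpha>) = v \<alpha> * Min (term_val f ` ?I)" using i t(3) by simp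
qed

lemma ev_mod: "ev f \<alpha> = ev (f mod \<phi>) \<alpha>"
proof -
  have "ev (\<phi> * (f div \<phi>) + f mod \<phi>) \<alpha> = ev (f mod \<phi>) \<alpha>"
    unfolding up_add up_mult poly_add poly_mult root by simp
  then show ?thesis by simp
qed

lemma degree_mod: "degree (f mod \<phi>) < n"
  using degree_mod_less[of \<phi> f] n_pos by fastforce

lemma ev_eq_0_iff: "ev f \<alpha> = 0 \<longleftrightarrow> \<phi> dvd f"
  using v_ev(1)[OF _ degree_mod, of f] by (auto simp: ev_mod[of f] mod_eq_0_iff_dvd)

text \<open>All values of \<open>K(\<alpha>)\<close> are multiples of \<open>v \<alpha>\<close>, so \<open>\<alpha>\<close> is a uniformizer as soon as \<open>K(\<alpha>)\<close>
  contains one.\<close>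

lemma v_root_eq_1:
  assumes "\<beta> \<in> adjoin_root \<alpha>" "\<beta> \<noteq> 0" "v \<beta> = 1"
  shows "v \<alpha> = 1"
proof -
  obtain f where f: "\<beta> = ev f \<alpha>" using assms(1) by (rule adjoin_rootE)
  have "f mod \<phi> \<noteq> 0" using assms(2) f ev_mod[of f] by auto
  then have "v \<alpha> dvd 1" using v_ev(2)[OF _ degree_mod] assms(3) f ev_mod[of f] by (metis dvd_triv_left)
  then show ?thesis using v_root_pos by simp
qed

end

locale eisenstein_uniformizer = eisenstein_root F v vK e \<phi> \<alpha>
  for F :: "'k::field alg_closure set" and v vK e \<phi> \<alpha> +
  assumes v_root: "v \<alpha> = 1" and F_eq: "F = adjoin_root \<alpha>"
begin

lemma e_eq: "e = int n"
  using ramification_index v_root by simp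

text \<open>Since \<open>i < n\<close>, a term \<open>c\<^sub>i \<alpha>\<^sup>i\<close> of nonnegative value \<open>n v(c\<^sub>i) + i\<close> has an integral coefficient, and
  its value is positive unless \<open>i = 0\<close>. So the residue field of \<open>L\<close> is that of \<open>K\<close>.\<close>

lemma integral_expansion:
  assumes "x \<in> fid 0"
  obtains f where "x = ev f \<alpha>" "coeff f 0 = 0 \<or> 0 \<le> vK (coeff f 0)"
    "\<And>i. i > 0 \<Longrightarrow> to_ac (coeff f i) * \<alpha> ^ i \<in> fid 1" "x - to_ac (coeff f 0) \<in> fid 1"
proof -
  obtain g where g: "x = ev g \<alpha>" using fid_mem[OF assms] F_eq adjoin_rootE by metis
  define f where "f = g mod \<phi>"
  have f: "x = ev f \<alpha>" "degree f < n" using g ev_mod degree_mod by (auto simp: f_def)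
  have val: "0 \<le> term_val f i" if "coeff f i \<noteq> 0" for i
  proof -
    have "f \<noteq> 0" using that by auto
    then have "0 \<le> Min (term_val f ` {i. coeff f i \<noteq> 0})"
      using v_ev[of f] f assms v_root by (auto simp: fid_def)
    moreover have "finite {i. coeff f i \<noteq> 0}"
      by (rule finite_subset[of _ "{..degree f}"]) (auto intro: le_degree)
    ultimately show ?thesis using that by (meson Min_le finite_imageI imageI mem_Collect_eq order_trans)
  qed
  have nonneg: "0 \<le> vK (coeff f i)" if "coeff f i \<noteq> 0" for i
  proof (rule ccontr)
    assume "\<not> 0 \<le> vK (coeff f i)"
    then have "int n * vK (coeff f i) \<le> int n * (- 1)" by (intro mult_left_mono) auto
    moreover have "i < n" using le_degree[OF that] f(2) by simp
    ultimately show False using val[OF that] by (simp add: term_val_def)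
  qed
  have pos: "to_ac (coeff f i) * \<alpha> ^ i \<in> fid 1" if "i > 0" for i
  proof (cases "coeff f i = 0")
    case False
    have "to_ac (coeff f i) * \<alpha> ^ i \<in> fid (e * 0 + int i * v \<alpha>)"
      using nonneg[OF False] by (intro fid_mult base_fid power_fid root_mem root_nonzero) auto
    from fid_mono[OF this] show ?thesis using that v_root by simp
  qed simp
  have "x - to_ac (coeff f 0) = (\<Sum>i\<in>{0<..degree f}. to_ac (coeff f i) * \<alpha> ^ i)"
    unfolding f(1) poly_altdef
    by (simp add: atMost_atLeast0 sum.head)
  also have "\<dots> \<in> fid 1" using pos by (intro fid_sum) auto
  finally have "x - to_ac (coeff f 0) \<in> fid 1" .
  then show ?thesis using f(1) nonneg pos by (intro that[of f]) auto
qed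

section \<open>Ramification polynomials of two uniformizers\<close>

lemma ramification_poly_integral:
  shows "pfid 0 (ramification_poly \<phi> \<alpha>)" "coeff (ramification_poly \<phi> \<alpha>) n = 1"
    "degree (ramification_poly \<phi> \<alpha>) = n"
proof -
  have "to_ac (coeff \<phi> i) * \<alpha> ^ i \<in> fid (int n)" for i
  proof -
    consider "i < n" | "i = n" | "i > n" by linarith
    then show ?thesis
    proof cases
      case 1
      have "to_ac (coeff \<phi> i) * \<alpha> ^ i \<in> fid (e * 1 + int i * v \<alpha>)"
        using low_coeffs[OF 1] by (intro fid_mult base_fid power_fid root_mem root_nonzero) auto
      from fid_mono[OF this] show ?thesis using e_eq v_root by simp
    next
      case 2
      then show ?thesis using monic power_fid[OF root_mem root_nonzero, of n] v_root by simp
    qed (simp add: coeff_eq_0)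
  qed
  then have "pfid (int n) (pcompose (up \<phi>) [:\<alpha>, \<alpha>:])"
    by (intro pfid_taylor) simp
  moreover have "inverse (\<alpha> ^ n) \<in> fid (- int n)"
    using root_mem root_nonzero v_root by (simp add: fid_def v_inverse power_mem inverse_mem v_power)
  ultimately show "pfid 0 (ramification_poly \<phi> \<alpha>)"
    unfolding ramification_poly_def using pfid_smult by fastforce
  have deg: "degree (pcompose (up \<phi>) [:\<alpha>, \<alpha>:]) = n"
    using root_nonzero by (simp add: degree_pcompose)
  then show "degree (ramification_poly \<phi> \<alpha>) = n"
    using root_nonzero by (simp add: ramification_poly_def)
  have "Polynomial.lead_coeff (pcompose (up \<phi>) [:\<alpha>, \<alpha>:]) = \<alpha> ^ n"
    using root_nonzero monic by (subst Polynomial.lead_coeff_comp) auto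
  then show "coeff (ramification_poly \<phi> \<alpha>) n = 1"
    using root_nonzero deg by (simp add: ramification_poly_def)
qed

text \<open>Write \<open>\<beta> = g(\<alpha>)\<close> with \<open>g = x f(x)\<close>. Then \<open>\<phi>\<close> divides \<open>\<psi> \<circ> g\<close>, and in the scaled variable the
  substitution \<open>g\<close> becomes \<open>x (1 + M(x))\<close> with \<open>M\<close> divisible by the uniformizer, because
  \<open>f(\<alpha> + \<alpha> x)\<close> is congruent to the unit \<open>f(\<alpha>) = \<beta> / \<alpha>\<close>.\<close>

lemma ramification_polys_close:
  assumes \<psi>: "eisenstein_uniformizer F v vK e \<psi> \<beta>"
  shows "envelope_close (ramification_poly \<phi> \<alpha>) (ramification_poly \<psi> \<beta>)"
    "envelope_close (ramification_poly \<psi> \<beta>) (ramification_poly \<phi> \<alpha>)"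
proof -
  interpret B: eisenstein_uniformizer F v vK e \<psi> \<beta> by fact
  have n: "degree \<psi> = n" using e_eq B.e_eq by simp
  define u where "u = \<beta> / \<alpha>"
  have u: "u \<in> F" "u \<noteq> 0" "v u = 0" "\<beta> = \<alpha> * u"
    using root_mem root_nonzero v_root B.root_mem B.root_nonzero B.v_root
    by (auto simp: u_def divide_inverse mult_mem inverse_mem v_mult v_inverse)
  obtain f where f: "u = ev f \<alpha>" "\<And>i. i > 0 \<Longrightarrow> to_ac (coeff f i) * \<alpha> ^ i \<in> fid 1"
    "u - to_ac (coeff f 0) \<in> fid 1"
    using integral_expansion[of u] u by (auto simp: fid_def)
  define H where "H = pcompose (up f) [:\<alpha>, \<alpha>:]"
  have "pfid 1 (pcompose (up f - [:to_ac (coeff f 0):]) [:\<alpha>, \<alpha>:])"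
    using f(2) by (intro pfid_taylor) (auto simp: coeff_pCons simp del: power_Suc split: nat.split)
  then have "pfid 1 (H - [:to_ac (coeff f 0):])"
    by (simp add: H_def pcompose_diff)
  moreover have "pfid 1 [:to_ac (coeff f 0) - u:]"
    using fid_uminus[OF f(3)] by (intro pfid_pCons) auto
  ultimately have "pfid 1 (H - [:to_ac (coeff f 0):] + [:to_ac (coeff f 0) - u:])"
    by (rule pfid_add)
  then have H: "pfid 1 (H - [:u:])"
    by (rule back_subst[of "pfid 1"]) (simp add: poly_eq_iff coeff_pCons split: nat.split)
  define E where "E = smult (inverse u) ([:1, 1:] * (H - [:u:]))"
  have "pfid (0 + (0 + 1)) E"
    unfolding E_def using u H
    by (intro pfid_smult pfid_mult pfid_pCons fid_one) (auto simp: fid_def inverse_mem v_inverse)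
  moreover have "coeff E 0 = 0"
    by (simp add: E_def H_def f(1) coeff_mult_0)
  ultimately obtain M where M: "E = pCons 0 M" "pfid 1 M"
    by (cases E) (auto simp: pfid_def, metis coeff_pCons_Suc)
  let ?G = "pCons 0 (1 + M)" and ?g = "pCons 0 f"
  have "smult u E = [:1, 1:] * (H - [:u:])" using u(2) by (simp add: E_def)
  have "smult \<beta> E = smult \<alpha> (smult u E)" using u(4) by simp
  also have "\<dots> = [:\<alpha>, \<alpha>:] * (H - [:u:])"
    unfolding \<open>smult u E = _\<close> by (simp add: smult_diff_right smult_add_right)
  also have "\<dots> = [:\<alpha>, \<alpha>:] * H - [:\<alpha>, \<alpha>:] * [:u:]" by (rule right_diff_distrib)
  also have "[:\<alpha>, \<alpha>:] * [:u:] = [:\<beta>, \<beta>:]" using u(4) by simp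
  finally have E: "smult \<beta> E = [:\<alpha>, \<alpha>:] * H - [:\<beta>, \<beta>:]" .
  have "pcompose [:\<beta>, \<beta>:] ?G = [:\<beta>, \<beta>:] + smult \<beta> E"
    by (simp add: pcompose_pCons M one_pCons smult_add_right)
  also have "\<dots> = pcompose (up ?g) [:\<alpha>, \<alpha>:]"
    unfolding E by (simp add: H_def pcompose_pCons)
  finally have G: "pcompose [:\<beta>, \<beta>:] ?G = pcompose (up ?g) [:\<alpha>, \<alpha>:]" .
  have "ev (pcompose \<psi> ?g) \<alpha> = 0"
    using B.root f(1) u(4) by (simp add: poly_pcompose)
  then obtain q where q: "pcompose \<psi> ?g = \<phi> * q"
    unfolding ev_eq_0_iff by (elim dvdE)
  have "pcompose (ramification_poly \<psi> \<beta>) ?G =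
      smult (inverse (\<beta> ^ n)) (pcompose (up \<psi>) (pcompose [:\<beta>, \<beta>:] ?G))"
    unfolding ramification_poly_def n by (simp only: pcompose_smult pcompose_assoc)
  also have "\<dots> = smult (inverse (\<beta> ^ n)) (pcompose (up (pcompose \<psi> ?g)) [:\<alpha>, \<alpha>:])"
    unfolding G by (simp only: pcompose_assoc up_pcompose)
  also have "\<dots> = smult (inverse (\<beta> ^ n)) (pcompose (up \<phi>) [:\<alpha>, \<alpha>:] * pcompose (up q) [:\<alpha>, \<alpha>:])"
    unfolding q by (simp only: up_mult pcompose_mult)
  also have "\<dots> = ramification_poly \<phi> \<alpha> * smult (\<alpha> ^ n * inverse (\<beta> ^ n)) (pcompose (up q) [:\<alpha>, \<alpha>:])"
    using root_nonzero
    by (simp add: ramification_poly_def mult.commute[of "\<alpha> ^ n" "inverse (\<beta> ^ n)"] mult.assoc)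
  finally have eq: "pcompose (ramification_poly \<psi> \<beta>) ?G = \<dots>" .
  show "envelope_close (ramification_poly \<phi> \<alpha>) (ramification_poly \<psi> \<beta>)"
    "envelope_close (ramification_poly \<psi> \<beta>) (ramification_poly \<phi> \<alpha>)"
    using perturbed_divisor_close[OF _ _ _ _ _ _ M(2) eq, of n]
      ramification_poly_integral B.ramification_poly_integral n by auto
qed

end

section \<open>Segments of a Newton polygon\<close>

abbreviation support :: "'a::zero poly \<Rightarrow> nat set" where
  "support f \<equiv> {i. coeff f i \<noteq> 0}"

lemma finite_support: "finite (support f)"
  by (rule finite_subset[of _ "{..degree f}"]) (auto intro: le_degree)

lemma closed_segment_on_line:
  fixes s c x1 x2 :: real
  assumes "x1 < x2"
  shows "(x, y) \<in> closed_segment (x1, c + s * x1) (x2, c + s * x2) \<longleftrightarrow> x1 \<le> x \<and> x \<le> x2 \<and> y = c + s * x"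
proof
  assume "(x, y) \<in> closed_segment (x1, c + s * x1) (x2, c + s * x2)"
  then obtain u where u: "0 \<le> u" "u \<le> 1" "x = (1 - u) * x1 + u * x2"
    "y = (1 - u) * (c + s * x1) + u * (c + s * x2)"
    by (auto simp: closed_segment_def)
  have "x = x1 + u * (x2 - x1)" using u(3) by (simp add: algebra_simps)
  moreover have "0 \<le> u * (x2 - x1)" "u * (x2 - x1) \<le> 1 * (x2 - x1)"
    using u assms by (auto intro: mult_right_mono)
  moreover have "y = c + s * x" unfolding u(3,4) by (simp add: algebra_simps)
  ultimately show "x1 \<le> x \<and> x \<le> x2 \<and> y = c + s * x" by simp
next
  assume *: "x1 \<le> x \<and> x \<le> x2 \<and> y = c + s * x"
  define u where "u = (x - x1) / (x2 - x1)"
  have u: "0 \<le> u" "u \<le> 1" using * assms by (auto simp: u_def field_simps)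
  have "u * (x2 - x1) = x - x1" using assms by (simp add: u_def)
  then have x: "x = (1 - u) * x1 + u * x2" by (simp add: algebra_simps)
  have "y = (1 - u) * (c + s * x1) + u * (c + s * x2)" using * by (simp add: x algebra_simps)
  then show "(x, y) \<in> closed_segment (x1, c + s * x1) (x2, c + s * x2)"
    using u x by (auto simp: closed_segment_def intro!: exI[of _ u])
qed

lemma (in linorder) sorted_key_list_of_set_props:
  assumes "inj_on f S" "finite S"
  shows "set (sorted_key_list_of_set f S) = S" "sorted_wrt (<) (map f (sorted_key_list_of_set f S))"
proof -
  interpret folding_insort_key "(\<le>)" "(<)" S f by unfold_locales (fact assms(1))
  show "set (sorted_key_list_of_set f S) = S" "sorted_wrt (<) (map f (sorted_key_list_of_set f S))"
    using assms(2) by simp_all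
qed

context
  fixes v :: "'a::field \<Rightarrow> int" and \<rho> :: "'a poly"
begin

abbreviation cv :: "nat \<Rightarrow> real" where "cv i \<equiv> real_of_int (v (coeff \<rho> i))"
abbreviation newton_hull :: "(real \<times> real) set" where "newton_hull \<equiv> convex hull (newton_point v \<rho> ` support \<rho>)"

text \<open>The segments are the contact sets of the nonvertical lines that support the hull in at least
  two points, with \<open>k\<close> and \<open>m\<close> the extreme points of contact. In this form, statements about
  segments become inequalities between affine functions of the index.\<close>

definition supporting_line :: "real \<Rightarrow> real \<Rightarrow> nat \<Rightarrow> nat \<Rightarrow> bool" where
  "supporting_line c s k m \<longleftrightarrow> k < m \<and> k \<in> support \<rho> \<and> m \<in> support \<rho> \<and>
     (\<forall>j\<in>support \<rho>. c + s * real j \<le> cv j) \<and> cv k = c + s * real k \<and> cv m = c + s * real m \<and>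
     (\<forall>j\<in>support \<rho>. cv j = c + s * real j \<longrightarrow> k \<le> j \<and> j \<le> m)"

lemma supporting_lineD:
  assumes "supporting_line c s k m"
  shows "k < m" "cv k = c + s * real k" "cv m = c + s * real m" "k \<in> support \<rho>" "m \<in> support \<rho>"
    "j \<in> support \<rho> \<Longrightarrow> c + s * real j \<le> cv j"
    "j \<in> support \<rho> \<Longrightarrow> j < k \<or> m < j \<Longrightarrow> c + s * real j < cv j"
  using assms unfolding supporting_line_def less_le by (blast, blast, blast, blast, blast, blast, force)

lemma point_in_hull: "i \<in> support \<rho> \<Longrightarrow> (real i, cv i) \<in> newton_hull"
  by (rule hull_inc) (auto simp: newton_point_def)

lemma polygon_iff:
  "(x, y) \<in> newton_polygon v \<rho> \<longleftrightarrow> (x, y) \<in> newton_hull \<and> (\<forall>y'. (x, y') \<in> newton_hull \<longrightarrow> y \<le> y')"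
  by (simp add: newton_polygon_def lower_hull_def)

lemma hull_above_line:
  assumes "\<And>j. j \<in> support \<rho> \<Longrightarrow> c + s * real j \<le> cv j" "(x, y) \<in> newton_hull"
  shows "c + s * x \<le> y"
proof -
  have "newton_hull \<subseteq> {z. inner (s, - 1) z \<le> - c}"
    using assms(1) by (intro hull_minimal convex_halfspace_le) (force simp: newton_point_def)
  then have "(x, y) \<in> {z. inner (s, - 1) z \<le> - c}" using assms(2) by blast
  then show ?thesis by simp
qed

lemma chord_in_hull:
  assumes "i \<in> support \<rho>" "j \<in> support \<rho>" "i < j" "real i \<le> x" "x \<le> real j"
  shows "(x, ((real j - x) * cv i + (x - real i) * cv j) / (real j - real i)) \<in> newton_hull"
proof -
  define s where "s = (cv j - cv i) / (real j - real i)"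
  define c where "c = cv i - s * real i"
  have sj: "s * (real j - real i) = cv j - cv i" using assms(3) by (simp add: s_def)
  have e: "cv i = c + s * real i" "cv j = c + s * real j"
    using sj by (auto simp: c_def algebra_simps)
  have "(x, c + s * x) \<in> closed_segment (real i, cv i) (real j, cv j)"
    unfolding e using assms by (subst closed_segment_on_line) auto
  also have "\<dots> \<subseteq> newton_hull"
    by (rule closed_segment_subset) (use assms point_in_hull in auto)
  also have "c + s * x = ((real j - x) * cv i + (x - real i) * cv j) / (real j - real i)"
    unfolding e using assms(3) by (simp add: field_simps)
  finally show ?thesis .
qed

lemma polygon_below_chord:
  assumes "i \<in> support \<rho>" "j \<in> support \<rho>" "i < j" "real i \<le> x" "x \<le> real j"
    and "(x, y) \<in> newton_polygon v \<rho>"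
  shows "y * (real j - real i) \<le> (real j - x) * cv i + (x - real i) * cv j"
proof -
  have "y \<le> ((real j - x) * cv i + (x - real i) * cv j) / (real j - real i)"
    using chord_in_hull[OF assms(1-5)] assms(6) by (auto simp: polygon_iff)
  then show ?thesis using assms(3) by (simp add: field_simps)
qed

text \<open>No point of the hull continues the contact beyond \<open>k\<close> and \<open>m\<close>: the points strictly
  above the line and the contact segment together form a convex set.\<close>

lemma supporting_line_hull:
  assumes "supporting_line c s k m" "(x, c + s * x) \<in> newton_hull"
  shows "real k \<le> x \<and> x \<le> real m"
proof -
  let ?C = "{z. c + s * fst z \<le> snd z \<and> (snd z = c + s * fst z \<longrightarrow> real k \<le> fst z \<and> fst z \<le> real m)}"
  have "convex ?C"
  proof (rule convexI)
    fix z w :: "real \<times> real" and t r :: real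
    assume zw: "z \<in> ?C" "w \<in> ?C" and tr: "0 \<le> t" "0 \<le> r" "t + r = 1"
    let ?f = "\<lambda>z. snd z - (c + s * fst z)"
    have f: "?f (t *\<^sub>R z + r *\<^sub>R w) = t * ?f z + r * ?f w"
    proof -
      have "t * c + r * c = (t + r) * c" by (rule distrib_right[symmetric])
      then show ?thesis unfolding tr(3) by (simp add: algebra_simps)
    qed
    have nn: "0 \<le> t * ?f z" "0 \<le> r * ?f w" using zw tr by auto
    show "t *\<^sub>R z + r *\<^sub>R w \<in> ?C"
    proof (cases "t = 0 \<or> r = 0")
      case True
      then show ?thesis using zw tr by auto
    next
      case False
      have "real k \<le> fst (t *\<^sub>R z + r *\<^sub>R w) \<and> fst (t *\<^sub>R z + r *\<^sub>R w) \<le> real m"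
        if "?f (t *\<^sub>R z + r *\<^sub>R w) = 0"
      proof -
        have "t * ?f z = 0" "r * ?f w = 0" using f nn that by linarith+
        then have "real k \<le> fst z" "fst z \<le> real m" "real k \<le> fst w" "fst w \<le> real m"
          using False zw by auto
        then have "fst z \<in> {real k..real m}" "fst w \<in> {real k..real m}" by auto
        then have "t *\<^sub>R fst z + r *\<^sub>R fst w \<in> {real k..real m}"
          using tr convex_real_interval(5) by (meson convexD)
        then show ?thesis by simp
      qed
      then show ?thesis using f nn by auto
    qed
  qed
  then have "newton_hull \<subseteq> ?C"
    using assms(1) by (intro hull_minimal) (auto simp: newton_point_def supporting_line_def)
  then show ?thesis using assms(2) by auto
qed

lemma supporting_line_in_polygon:
  assumes "supporting_line c s k m"
  shows "closed_segment (newton_point v \<rho> k) (newton_point v \<rho> m) \<subseteq> newton_polygon v \<rho>"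
proof
  fix z assume z: "z \<in> closed_segment (newton_point v \<rho> k) (newton_point v \<rho> m)"
  obtain x y where xy: "z = (x, y)" by (cases z)
  have km: "k < m" "cv k = c + s * real k" "cv m = c + s * real m" "k \<in> support \<rho>" "m \<in> support \<rho>"
    using assms by (auto simp: supporting_line_def)
  have "y = c + s * x"
    using z km closed_segment_on_line[of "real k" "real m" x y c s] by (simp add: newton_point_def xy)
  moreover have "z \<in> newton_hull"
    using z closed_segment_subset[OF point_in_hull[OF km(4)] point_in_hull[OF km(5)]]
    by (auto simp: newton_point_def)
  moreover have "c + s * x \<le> y'" if "(x, y') \<in> newton_hull" for y'
    using that assms hull_above_line unfolding supporting_line_def by blast
  ultimately show "z \<in> newton_polygon v \<rho>" by (simp add: xy polygon_iff)
qed

text \<open>The end points of a larger segment in the polygon are on the line as well, since a convex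
  combination of nonnegative heights above the line can only vanish if the heights do.\<close>

lemma supporting_line_imp_segment:
  assumes l: "supporting_line c s k m"
  shows "(k, m) \<in> newton_segments v \<rho>"
proof -
  let ?s = "closed_segment (newton_point v \<rho> k) (newton_point v \<rho> m)"
  have km: "k < m" "cv k = c + s * real k" "cv m = c + s * real m" "coeff \<rho> k \<noteq> 0" "coeff \<rho> m \<noteq> 0"
    using l by (auto simp: supporting_line_def)
  have seg: "(x, y) \<in> ?s \<longleftrightarrow> real k \<le> x \<and> x \<le> real m \<and> y = c + s * x" for x y
    using closed_segment_on_line[of "real k" "real m" x y c s] km by (simp add: newton_point_def)
  have "closed_segment p q = ?s"
    if pq: "?s \<subseteq> closed_segment p q" "closed_segment p q \<subseteq> newton_polygon v \<rho>" for p q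
  proof
    let ?f = "\<lambda>z. snd z - (c + s * fst z)"
    have newton_hull: "p \<in> newton_hull" "q \<in> newton_hull" using pq(2) by (auto simp: newton_polygon_def lower_hull_def)
    have nn: "0 \<le> ?f p" "0 \<le> ?f q"
      using newton_hull l hull_above_line[of c s "fst p" "snd p"] hull_above_line[of c s "fst q" "snd q"]
      by (auto simp: supporting_line_def)
    have "newton_point v \<rho> k \<in> closed_segment p q" "newton_point v \<rho> m \<in> closed_segment p q"
      using pq(1) by auto
    then obtain t r where
      t: "0 \<le> t" "t \<le> 1" "newton_point v \<rho> k = (1 - t) *\<^sub>R p + t *\<^sub>R q" and
      r: "0 \<le> r" "r \<le> 1" "newton_point v \<rho> m = (1 - r) *\<^sub>R p + r *\<^sub>R q"
      by (auto simp: closed_segment_def)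
    have f: "?f ((1 - t) *\<^sub>R p + t *\<^sub>R q) = (1 - t) * ?f p + t * ?f q" for t
      by (simp add: algebra_simps)
    have "(1 - t) * ?f p + t * ?f q = 0" "(1 - r) * ?f p + r * ?f q = 0"
      using f[of t] f[of r] km unfolding t(3)[symmetric] r(3)[symmetric]
      by (auto simp: newton_point_def)
    moreover have "0 \<le> (1 - t) * ?f p" "0 \<le> t * ?f q" "0 \<le> (1 - r) * ?f p" "0 \<le> r * ?f q"
      using nn t r by auto
    ultimately have "(1 - t) * ?f p = 0" "t * ?f q = 0" "(1 - r) * ?f p = 0" "r * ?f q = 0"
      by linarith+
    moreover have "t \<noteq> r"
    proof
      assume "t = r"
      then have "newton_point v \<rho> k = newton_point v \<rho> m" using t(3) r(3) by simp
      then show False using km(1) by (simp add: newton_point_def)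
    qed
    ultimately have f0: "?f p = 0" "?f q = 0" by auto
    then have "p = (fst p, c + s * fst p)" "q = (fst q, c + s * fst q)"
      by (auto simp: prod_eq_iff)
    then have "p \<in> ?s" "q \<in> ?s"
      using supporting_line_hull[OF l] newton_hull seg by metis+
    then show "closed_segment p q \<subseteq> ?s"
      by (simp add: subset_closed_segment)
  qed (fact pq(1))
  then show ?thesis
    using km supporting_line_in_polygon[OF l] unfolding newton_segments_def Let_def by blast
qed

text \<open>A point below the line through the end points of a segment would pull the hull below
  the segment or one of its end points. By maximality, no contact point lies outside the segment.\<close>

lemma segment_imp_supporting_line:
  assumes seg: "(k, m) \<in> newton_segments v \<rho>"
  obtains c s where "supporting_line c s k m"
proof -
  let ?s = "closed_segment (newton_point v \<rho> k) (newton_point v \<rho> m)"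
  have km: "k < m" "k \<in> support \<rho>" "m \<in> support \<rho>" and s: "?s \<subseteq> newton_polygon v \<rho>"
    and max: "\<And>p q. ?s \<subseteq> closed_segment p q \<Longrightarrow> closed_segment p q \<subseteq> newton_polygon v \<rho> \<Longrightarrow>
      closed_segment p q = ?s"
    using seg unfolding newton_segments_def Let_def by blast+
  define s where "s = (cv m - cv k) / (real m - real k)"
  define c where "c = cv k - s * real k"
  have sm: "s * (real m - real k) = cv m - cv k" using km(1) by (simp add: s_def)
  have e: "cv k = c + s * real k" "cv m = c + s * real m"
    using sm by (auto simp: c_def algebra_simps)
  have on: "(x, c + s * x) \<in> newton_polygon v \<rho>" if "real k \<le> x" "x \<le> real m" for x
    using that closed_segment_on_line[of "real k" "real m" x "c + s * x" c s] s km e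
    by (auto simp: newton_point_def)
  have below: "c + s * real j \<le> cv j" if j: "j \<in> support \<rho>" for j
  proof -
    consider "j < k" | "k \<le> j" "j \<le> m" | "m < j" by linarith
    then show ?thesis
    proof cases
      case 1
      have "cv k * (real m - real j) \<le> (real m - real k) * cv j + (real k - real j) * cv m"
        using polygon_below_chord[OF j km(3), of "real k" "cv k"] on[of "real k"] 1 km e by auto
      then have "(real m - real k) * (c + s * real j) \<le> (real m - real k) * cv j"
        unfolding e by (simp add: algebra_simps)
      then show ?thesis using km(1) by simp
    next
      case 2
      then show ?thesis using on[of "real j"] point_in_hull[OF j] by (auto simp: polygon_iff)
    next
      case 3
      have "cv m * (real j - real k) \<le> (real j - real m) * cv k + (real m - real k) * cv j"
        using polygon_below_chord[OF km(2) j, of "real m" "cv m"] on[of "real m"] 3 km e by auto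
      then have "(real m - real k) * (c + s * real j) \<le> (real m - real k) * cv j"
        unfolding e by (simp add: algebra_simps)
      then show ?thesis using km(1) by simp
    qed
  qed
  define E where "E = {j \<in> support \<rho>. cv j = c + s * real j}"
  have E: "finite E" "k \<in> E" "m \<in> E"
    using finite_subset[OF _ finite_support, of E \<rho>] km e by (auto simp: E_def)
  define k' m' where "k' = Min E" and "m' = Max E"
  have km': "k' \<le> k" "m \<le> m'" "k' \<in> E" "m' \<in> E"
  proof -
    have "E \<noteq> {}" using E(2) by auto
    then show "k' \<in> E" "m' \<in> E" unfolding k'_def m'_def using E(1) by simp_all
    show "k' \<le> k" "m \<le> m'" unfolding k'_def m'_def using E by simp_all
  qed
  have l: "supporting_line c s k' m'"
  proof -
    have "k' \<le> j \<and> j \<le> m'" if "j \<in> E" for j using that E(1) by (simp add: k'_def m'_def)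
    then show ?thesis using km' km below by (auto simp: supporting_line_def E_def)
  qed
  have pt: "newton_point v \<rho> j = (real j, c + s * real j)" if "j \<in> E" for j
    using that by (simp add: newton_point_def E_def)
  have "?s \<subseteq> closed_segment (newton_point v \<rho> k') (newton_point v \<rho> m')"
    using km km' E by (auto simp: pt closed_segment_on_line)
  from max[OF this supporting_line_in_polygon[OF l]]
  have "newton_point v \<rho> k' \<in> ?s" "newton_point v \<rho> m' \<in> ?s" by (metis ends_in_segment)+
  then have "k' = k" "m' = m"
    using km km' E by (auto simp: pt closed_segment_on_line)
  then show ?thesis using that l by auto
qed

lemma segment_bounds:
  assumes "(k, m) \<in> newton_segments v \<rho>"
  shows "k < m" "coeff \<rho> k \<noteq> 0" "coeff \<rho> m \<noteq> 0" "m \<le> degree \<rho>"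
proof -
  show km: "k < m" "coeff \<rho> k \<noteq> 0" "coeff \<rho> m \<noteq> 0"
    using assms unfolding newton_segments_def by blast+
  then show "m \<le> degree \<rho>" by (intro le_degree)
qed

lemma finite_segments: "finite (newton_segments v \<rho>)"
proof (rule finite_subset)
  show "newton_segments v \<rho> \<subseteq> {..degree \<rho>} \<times> {..degree \<rho>}"
    using le_degree[OF segment_bounds(2)] segment_bounds(4) by auto
qed simp

text \<open>The difference of the two supporting lines is affine, and an overlap would make it change its
  sign twice.\<close>

lemma segments_disjoint:
  assumes "(k, m) \<in> newton_segments v \<rho>" "(k', m') \<in> newton_segments v \<rho>" "k < k'"
  shows "m \<le> k'"
proof (rule ccontr)
  assume "\<not> m \<le> k'"
  obtain c s where l: "supporting_line c s k m" using assms(1) by (rule segment_imp_supporting_line)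
  obtain c' s' where l': "supporting_line c' s' k' m'" using assms(2) by (rule segment_imp_supporting_line)
  have "c + s * real k > c' + s' * real k" "c + s * real k' \<le> c' + s' * real k'"
    "c + s * real m \<ge> c' + s' * real m"
    using supporting_lineD[OF l] supporting_lineD[OF l'] assms(3) by metis+
  then have 1: "(s - s') * (real k' - real k) < 0" and 2: "0 \<le> (s - s') * (real m - real k')"
    by (auto simp: algebra_simps)
  have "s - s' < 0" using 1 assms(3) by (simp add: mult_less_0_iff)
  moreover have "real m - real k' > 0" using \<open>\<not> m \<le> k'\<close> by simp
  ultimately have "(s - s') * (real m - real k') < 0" by (rule mult_neg_pos)
  then show False using 2 by simp
qed

lemma segments_inj:
  assumes "(k, m) \<in> newton_segments v \<rho>" "(k, m') \<in> newton_segments v \<rho>"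
  shows "m = m'"
proof -
  have False if kmm: "(k, m) \<in> newton_segments v \<rho>" "(k, m') \<in> newton_segments v \<rho>" "m < m'" for m m'
  proof -
    obtain c s where l: "supporting_line c s k m" using kmm(1) by (rule segment_imp_supporting_line)
    obtain c' s' where l': "supporting_line c' s' k m'" using kmm(2) by (rule segment_imp_supporting_line)
    have "c + s * real k = c' + s' * real k" "c + s * real m \<ge> c' + s' * real m"
      "c + s * real m' < c' + s' * real m'" "k < m"
      using supporting_lineD[OF l] supporting_lineD[OF l'] kmm(3) by metis+
    then have 1: "0 \<le> (s - s') * (real m - real k)" and 2: "(s - s') * (real m' - real k) < 0"
      by (auto simp: algebra_simps)
    have "0 \<le> s - s'" using 1 \<open>k < m\<close> by (simp add: zero_le_mult_iff)
    then have "0 \<le> (s - s') * (real m' - real k)" using \<open>k < m\<close> kmm(3) by simp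
    then show False using 2 by simp
  qed
  then show ?thesis using assms by (metis linorder_neqE_nat)
qed

lemma next_segment:
  assumes "(k, m) \<in> newton_segments v \<rho>" "m < degree \<rho>"
  obtains m' where "(m, m') \<in> newton_segments v \<rho>"
proof -
  obtain c s where l: "supporting_line c s k m" using assms(1) by (rule segment_imp_supporting_line)
  \<comment> \<open>the next segment leaves the vertex at \<open>m\<close> with the least slope towards a later point\<close>
  define J where "J = {j \<in> support \<rho>. m < j}"
  define q where "q j = (cv j - cv m) / (real j - real m)" for j
  have J: "finite J" "J \<noteq> {}"
    using finite_support[of \<rho>] assms(2) unfolding J_def
    by (auto intro!: exI[of _ "degree \<rho>"])
  define s' where "s' = Min (q ` J)"
  define m' where "m' = Max {j \<in> J. q j = s'}"
  define c' where "c' = cv m - s' * real m"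
  have "s' \<in> q ` J" unfolding s'_def using J by (intro Min_in) auto
  then have ne: "{j \<in> J. q j = s'} \<noteq> {}" by auto
  have m': "m' \<in> J" "q m' = s'" "\<And>j. j \<in> J \<Longrightarrow> q j = s' \<Longrightarrow> j \<le> m'"
    using Max_in[OF _ ne] J by (auto simp: m'_def)
  have s'_le: "s' \<le> q j" if "j \<in> J" for j using that J by (simp add: s'_def)
  have line: "q j * (real j - real m) = cv j - cv m" if "j \<in> J" for j
    using that by (simp add: q_def J_def)
  have later: "c' + s' * real j \<le> cv j" "cv j = c' + s' * real j \<Longrightarrow> j \<le> m'" if "j \<in> J" for j
  proof -
    have "s' * (real j - real m) \<le> q j * (real j - real m)"
      using s'_le[OF that] that by (intro mult_right_mono) (auto simp: J_def)
    then show "c' + s' * real j \<le> cv j" using line[OF that] by (simp add: c'_def algebra_simps)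
    assume "cv j = c' + s' * real j"
    then have "(q j - s') * (real j - real m) = 0" using line[OF that] by (simp add: c'_def algebra_simps)
    then show "j \<le> m'" using m'(3)[OF that] that by (auto simp: J_def)
  qed
  have "m \<in> support \<rho>" "cv m = c + s * real m" using l by (auto simp: supporting_line_def)
  have "s < s'"
  proof -
    have "c + s * real m' < cv m'"
      using supporting_lineD(7)[OF l, of m'] m'(1) by (auto simp: J_def)
    then have "(s' - s) * (real m' - real m) > 0"
      using line[OF m'(1)] m'(2) \<open>cv m = _\<close> by (simp add: algebra_simps)
    then show ?thesis using m'(1) by (simp add: zero_less_mult_iff J_def)
  qed
  have earlier: "c' + s' * real j < cv j" if "j \<in> support \<rho>" "j < m" for j
  proof -
    have "s' * (real j - real m) < s * (real j - real m)"
      using \<open>s < s'\<close> that by (intro mult_strict_right_mono_neg) auto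
    moreover have "c + s * real j \<le> cv j" using l that by (auto simp: supporting_line_def)
    ultimately show ?thesis using \<open>cv m = _\<close> by (simp add: c'_def algebra_simps)
  qed
  have "supporting_line c' s' m m'"
    unfolding supporting_line_def
  proof (intro conjI ballI impI)
    show "m < m'" "m' \<in> support \<rho>" using m'(1) by (auto simp: J_def)
    show "cv m = c' + s' * real m" by (simp add: c'_def)
    show "cv m' = c' + s' * real m'" using line[OF m'(1)] m'(2) by (simp add: c'_def algebra_simps)
    fix j assume j: "j \<in> support \<rho>"
    have *: "c' + s' * real j \<le> cv j \<and> (cv j = c' + s' * real j \<longrightarrow> m \<le> j \<and> j \<le> m')"
    proof (cases j m rule: linorder_cases)
      case less
      then show ?thesis using earlier[OF j] by auto
    next
      case equal
      then show ?thesis using m'(1) by (simp add: c'_def J_def)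
    next
      case greater
      then have "j \<in> J" using j by (simp add: J_def)
      from later[OF this] greater show ?thesis by auto
    qed
    then show "c' + s' * real j \<le> cv j" by blast
    assume "cv j = c' + s' * real j"
    with * show "m \<le> j" "j \<le> m'" by blast+
  qed fact
  then show ?thesis using that supporting_line_imp_segment by blast
qed

lemma segment_list:
  shows "set (newton_segment_list v \<rho>) = newton_segments v \<rho>"
    and "sorted_wrt (\<lambda>s s'. fst s < fst s') (newton_segment_list v \<rho>)"
proof -
  have inj: "inj_on fst (newton_segments v \<rho>)"
    by (auto simp: inj_on_def dest: segments_inj)
  show "set (newton_segment_list v \<rho>) = newton_segments v \<rho>"
    "sorted_wrt (\<lambda>s s'. fst s < fst s') (newton_segment_list v \<rho>)"
    using sorted_key_list_of_set_props[OF inj finite_segments]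
    by (simp_all add: newton_segment_list_def sorted_wrt_map)
qed

text \<open>Segments do not overlap, and one starts at the right end of each segment that ends before the
  degree. So no list entry fits between a segment and the one that continues it.\<close>

lemma segment_list_contiguous:
  shows "successively (\<lambda>s s'. snd s = fst s') (newton_segment_list v \<rho>)"
    and "newton_segment_list v \<rho> \<noteq> [] \<Longrightarrow> snd (last (newton_segment_list v \<rho>)) = degree \<rho>"
proof -
  let ?xs = "newton_segment_list v \<rho>"
  have sorted: "fst (?xs ! i) < fst (?xs ! j)" if "i < j" "j < length ?xs" for i j
    using segment_list(2) that by (auto simp: sorted_wrt_iff_nth_less)
  have nxt: "\<exists>j<length ?xs. i < j \<and> fst (?xs ! j) = snd (?xs ! i)"
    if i: "i < length ?xs" "snd (?xs ! i) < degree \<rho>" for i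
  proof -
    obtain k m where km: "?xs ! i = (k, m)" by (cases "?xs ! i")
    then have seg: "(k, m) \<in> newton_segments v \<rho>" using nth_mem[OF i(1)] segment_list(1) by auto
    obtain m' where "(m, m') \<in> newton_segments v \<rho>" using next_segment[OF seg] i(2) km by auto
    then have "(m, m') \<in> set ?xs" using segment_list(1) by simp
    then obtain j where j: "j < length ?xs" "?xs ! j = (m, m')"
      by (auto simp: in_set_conv_nth)
    have "\<not> j \<le> i"
      using sorted[of j i] i(1) j km segment_bounds(1)[OF seg] by (cases "j = i") auto
    then show ?thesis using j km by auto
  qed
  show "successively (\<lambda>s s'. snd s = fst s') ?xs"
    unfolding successively_conv_nth
  proof (intro allI impI)
    fix i assume i: "Suc i < length ?xs"
    obtain k m k' m' where km: "?xs ! i = (k, m)" "?xs ! Suc i = (k', m')" by (metis surj_pair)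
    then have seg: "(k, m) \<in> newton_segments v \<rho>" "(k', m') \<in> newton_segments v \<rho>"
      using nth_mem[of i ?xs] nth_mem[OF i] i segment_list(1) by auto
    have "m \<le> k'" using segments_disjoint[OF seg] sorted[of i "Suc i"] i km by simp
    moreover from this have "m < degree \<rho>" using segment_bounds[OF seg(2)] by simp
    then obtain j where j: "j < length ?xs" "i < j" "fst (?xs ! j) = m"
      using nxt[of i] i km by auto
    have "k' \<le> m"
      using sorted[of "Suc i" j] j km by (cases "j = Suc i") auto
    ultimately show "snd (?xs ! i) = fst (?xs ! Suc i)" using km by simp
  qed
  assume ne: "?xs \<noteq> []"
  let ?i = "length ?xs - 1"
  have "snd (?xs ! ?i) \<le> degree \<rho>"
  proof -
    have "?xs ! ?i \<in> newton_segments v \<rho>"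
      using nth_mem[of ?i ?xs] ne segment_list(1) by simp
    then show ?thesis using segment_bounds(4) by (cases "?xs ! ?i") auto
  qed
  moreover have "\<not> snd (?xs ! ?i) < degree \<rho>"
  proof
    assume *: "snd (?xs ! ?i) < degree \<rho>"
    have "?i < length ?xs" using ne by simp
    from nxt[OF this *] obtain j where "j < length ?xs" "?i < j" by blast
    then show False by linarith
  qed
  ultimately show "snd (last ?xs) = degree \<rho>" using ne by (simp add: last_conv_nth)
qed

end

section \<open>Polygons of envelope-close polynomials\<close>

lemma convex_above:
  fixes C :: "(real \<times> real) set"
  assumes "convex C"
  shows "convex {(x, y). \<exists>y'\<le>y. (x, y') \<in> C}"
proof (rule convexI)
  fix z w :: "real \<times> real" and t r :: real
  assume zw: "z \<in> {(x, y). \<exists>y'\<le>y. (x, y') \<in> C}" "w \<in> {(x, y). \<exists>y'\<le>y. (x, y') \<in> C}"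
    and tr: "0 \<le> t" "0 \<le> r" "t + r = 1"
  obtain y y' where y: "y \<le> snd z" "(fst z, y) \<in> C" "y' \<le> snd w" "(fst w, y') \<in> C"
    using zw by auto
  have "t *\<^sub>R (fst z, y) + r *\<^sub>R (fst w, y') \<in> C"
    using assms y tr by (intro convexD)
  moreover have "t * y + r * y' \<le> t * snd z + r * snd w"
    using y tr by (intro add_mono mult_left_mono)
  ultimately show "t *\<^sub>R z + r *\<^sub>R w \<in> {(x, y). \<exists>y'\<le>y. (x, y') \<in> C}"
    by (auto simp: case_prod_beta)
qed

text \<open>The lower hull depends only on the region above the convex hull.\<close>

lemma lower_hull_eqI:
  assumes "\<And>x y. (x, y) \<in> S \<Longrightarrow> \<exists>y'\<le>y. (x, y') \<in> convex hull T"
    and "\<And>x y. (x, y) \<in> T \<Longrightarrow> \<exists>y'\<le>y. (x, y') \<in> convex hull S"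
  shows "lower_hull S = lower_hull T"
proof -
  have above: "\<exists>y'\<le>y. (x, y') \<in> convex hull T"
    if "\<And>x y. (x, y) \<in> S \<Longrightarrow> \<exists>y'\<le>y. (x, y') \<in> convex hull T" "(x, y) \<in> convex hull S" for S T :: "(real \<times> real) set" and x y
  proof -
    have "convex hull S \<subseteq> {(x, y). \<exists>y'\<le>y. (x, y') \<in> convex hull T}"
      using that(1) by (intro hull_minimal convex_above) auto
    then show ?thesis using that(2) by auto
  qed
  have "lower_hull S \<subseteq> lower_hull T"
    if ST: "\<And>x y. (x, y) \<in> S \<Longrightarrow> \<exists>y'\<le>y. (x, y') \<in> convex hull T"
      and TS: "\<And>x y. (x, y) \<in> T \<Longrightarrow> \<exists>y'\<le>y. (x, y') \<in> convex hull S" for S T :: "(real \<times> real) set"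
  proof
    fix z assume z: "z \<in> lower_hull S"
    obtain x y where xy: "z = (x, y)" by (cases z)
    have y: "(x, y) \<in> convex hull S" "\<And>y'. (x, y') \<in> convex hull S \<Longrightarrow> y \<le> y'"
      using z by (auto simp: lower_hull_def xy)
    have min: "y \<le> y'" if T: "(x, y') \<in> convex hull T" for y'
      using above[of T S x y', OF TS T] y(2) by force
    obtain y' where "y' \<le> y" "(x, y') \<in> convex hull T" using above[of S T x y, OF ST y(1)] by blast
    then have "(x, y) \<in> convex hull T" using min[of y'] by auto
    then show "z \<in> lower_hull T" using min by (auto simp: lower_hull_def xy)
  qed
  from this[of S T] this[of T S] show ?thesis using assms by blast
qed

context valued_subfield
begin

definition integral_monic :: "nat \<Rightarrow> 'a poly \<Rightarrow> bool" where
  "integral_monic n \<rho> \<longleftrightarrow> pfid 0 \<rho> \<and> coeff \<rho> n = 1 \<and> degree \<rho> = n"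

text \<open>Since the polygon ends at height 0 and all points have nonnegative height, it is
  nonincreasing. So its height at \<open>i\<close> bounds all values to the left of \<open>i\<close> as well.\<close>

lemma polygon_lower_bound:
  assumes \<rho>: "integral_monic n \<rho>" and on: "(real i, real_of_int t) \<in> newton_polygon v \<rho>"
    and ij: "j \<le> i" "i \<le> n"
  shows "coeff \<rho> j \<in> fid t"
proof (cases "coeff \<rho> j = 0")
  case False
  have F: "coeff \<rho> j \<in> F" and nn: "0 \<le> v (coeff \<rho> j)"
    using \<rho> False by (auto simp: integral_monic_def pfid_def fid_def)
  have n: "n \<in> support \<rho>" "v (coeff \<rho> n) = 0" using \<rho> v_one by (auto simp: integral_monic_def)
  have "t \<le> v (coeff \<rho> j)"
  proof (cases "j = n")
    case True
    then show ?thesis using on point_in_hull[OF n(1), of v] ij by (auto simp: polygon_iff)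
  next
    case lt: False
    have "real_of_int t * (real n - real j) \<le> (real n - real i) * real_of_int (v (coeff \<rho> j))"
      using polygon_below_chord[OF _ n(1) _ _ _ on, of j] False lt ij n(2) by auto
    also have "\<dots> \<le> (real n - real j) * real_of_int (v (coeff \<rho> j))"
      using ij nn by (intro mult_right_mono) auto
    finally show ?thesis using lt ij by (simp add: mult.commute)
  qed
  then show ?thesis using F by (simp add: fid_def)
qed simp

text \<open>Some coefficient of \<open>\<rho>'\<close> with index \<open>j \<le> i\<close> has at most the value of \<open>\<rho>\<^sub>i\<close>, as otherwise \<open>\<rho>\<^sub>i\<close>
  would have larger value. The chord from its point to the end \<open>(n, 0)\<close> descends and passes below
  the point of \<open>\<rho>\<^sub>i\<close>.\<close>

lemma support_above_hull:
  assumes \<rho>: "integral_monic n \<rho>" and \<rho>': "integral_monic n \<rho>'"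
    and close: "envelope_close \<rho>' \<rho>" and i: "i \<in> support \<rho>"
  shows "\<exists>y\<le>real_of_int (v (coeff \<rho> i)). (real i, y) \<in> newton_hull v \<rho>'"
proof -
  let ?t = "v (coeff \<rho> i)"
  have F: "coeff \<rho> i \<in> F" using \<rho> by (auto simp: integral_monic_def pfid_def fid_def)
  have "\<exists>j\<le>i. coeff \<rho>' j \<notin> fid (?t + 1)"
  proof (rule ccontr)
    assume "\<not> ?thesis"
    then have *: "coeff \<rho>' j \<in> fid (?t + 1)" if "j \<le> i" for j using that by blast
    have "coeff \<rho> i - coeff \<rho>' i \<in> fid (?t + 1)"
      using fid_mono[OF envelope_closeD[OF close *]] by simp
    from fid_add[OF this *[of i]] have "coeff \<rho> i \<in> fid (?t + 1)" by simp
    then show False using i F by (simp add: fid_def)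
  qed
  then obtain j where j: "j \<le> i" "coeff \<rho>' j \<notin> fid (?t + 1)" by blast
  have j': "j \<in> support \<rho>'" "0 \<le> v (coeff \<rho>' j)" "v (coeff \<rho>' j) \<le> ?t"
    using \<rho>' j(2) by (auto simp: integral_monic_def pfid_def fid_def zero_mem)
  have n: "n \<in> support \<rho>'" "v (coeff \<rho>' n) = 0" using \<rho>' v_one by (auto simp: integral_monic_def)
  have "i \<le> n" using i \<rho> by (auto simp: integral_monic_def intro: le_degree)
  show ?thesis
  proof (cases "j = i")
    case True
    have "(real i, real_of_int (v (coeff \<rho>' i))) \<in> newton_hull v \<rho>'"
      using point_in_hull[OF j'(1), of v] unfolding True .
    moreover have "real_of_int (v (coeff \<rho>' i)) \<le> real_of_int ?t" using j'(3) True by simp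
    ultimately show ?thesis by blast
  next
    case False
    then have "j < n" using j(1) \<open>i \<le> n\<close> by simp
    let ?y = "(real n - real i) * real_of_int (v (coeff \<rho>' j)) / (real n - real j)"
    have "?y \<le> (real n - real j) * real_of_int (v (coeff \<rho>' j)) / (real n - real j)"
      using j(1) j'(2) \<open>j < n\<close> by (intro divide_right_mono mult_right_mono) auto
    also have "\<dots> \<le> real_of_int ?t" using j'(3) \<open>j < n\<close> by simp
    finally have "?y \<le> real_of_int ?t" .
    moreover have "(real i, ?y) \<in> newton_hull v \<rho>'"
      using chord_in_hull[OF j'(1) n(1) \<open>j < n\<close>, of "real i" v] j(1) \<open>i \<le> n\<close> n(2) by simp
    ultimately show ?thesis by blast
  qed
qed

lemma newton_polygon_eq:
  assumes "integral_monic n \<rho>" "integral_monic n \<rho>'"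
    and "envelope_close \<rho> \<rho>'" "envelope_close \<rho>' \<rho>"
  shows "newton_polygon v \<rho> = newton_polygon v \<rho>'"
  unfolding newton_polygon_def
proof (rule lower_hull_eqI)
  fix x y
  show "\<exists>y'\<le>y. (x, y') \<in> newton_hull v \<rho>'" if xy: "(x, y) \<in> newton_point v \<rho> ` support \<rho>"
  proof -
    obtain i where "i \<in> support \<rho>" "x = real i" "y = real_of_int (v (coeff \<rho> i))"
      using xy by (auto simp: newton_point_def)
    then show ?thesis using support_above_hull[OF assms(1,2,4)] by blast
  qed
  show "\<exists>y'\<le>y. (x, y') \<in> newton_hull v \<rho>" if xy: "(x, y) \<in> newton_point v \<rho>' ` support \<rho>'"
  proof -
    obtain i where "i \<in> support \<rho>'" "x = real i" "y = real_of_int (v (coeff \<rho>' i))"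
      using xy by (auto simp: newton_point_def)
    then show ?thesis using support_above_hull[OF assms(2,1,3)] by blast
  qed
qed

lemma value_on_polygon:
  assumes "integral_monic n \<rho>" "envelope_close \<rho> \<rho>'"
    and "newton_point v \<rho> i \<in> newton_polygon v \<rho>" "coeff \<rho> i \<noteq> 0"
  shows "coeff \<rho>' i \<noteq> 0" "v (coeff \<rho>' i) = v (coeff \<rho> i)"
proof -
  have i: "i \<le> n" using assms(1,4) by (auto simp: integral_monic_def intro: le_degree)
  have "coeff \<rho> j \<in> fid (v (coeff \<rho> i))" if "j \<le> i" for j
    using polygon_lower_bound[OF assms(1) _ that i] assms(3) by (simp add: newton_point_def)
  then have "coeff \<rho>' i - coeff \<rho> i \<in> fid (v (coeff \<rho> i) + 1)"
    by (rule envelope_closeD[OF assms(2)])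
  moreover have "coeff \<rho> i \<in> F" using assms(1) by (auto simp: integral_monic_def pfid_def fid_def)
  ultimately show "coeff \<rho>' i \<noteq> 0" "v (coeff \<rho>' i) = v (coeff \<rho> i)"
    using v_cong_dominant assms(4) by blast+
qed

lemma segment_ends_on_polygon:
  assumes "(k, m) \<in> newton_segments v \<rho>"
  shows "newton_point v \<rho> k \<in> newton_polygon v \<rho>" "newton_point v \<rho> m \<in> newton_polygon v \<rho>"
proof -
  have "closed_segment (newton_point v \<rho> k) (newton_point v \<rho> m) \<subseteq> newton_polygon v \<rho>"
    using assms unfolding newton_segments_def Let_def by blast
  then show "newton_point v \<rho> k \<in> newton_polygon v \<rho>" "newton_point v \<rho> m \<in> newton_polygon v \<rho>"
    by auto
qed

lemma segment_values_eq:
  assumes "integral_monic n \<rho>" "envelope_close \<rho> \<rho>'" "(k, m) \<in> newton_segments v \<rho>"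
  shows "coeff \<rho>' k \<noteq> 0" "v (coeff \<rho>' k) = v (coeff \<rho> k)"
    "coeff \<rho>' m \<noteq> 0" "v (coeff \<rho>' m) = v (coeff \<rho> m)"
  using value_on_polygon[OF assms(1,2) segment_ends_on_polygon(1)[OF assms(3)] segment_bounds(2)[OF assms(3)]]
    value_on_polygon[OF assms(1,2) segment_ends_on_polygon(2)[OF assms(3)] segment_bounds(3)[OF assms(3)]]
  by simp_all

text \<open>The polygons agree, and at the end points of the segments so do the points.\<close>

lemma newton_segments_eq:
  assumes "integral_monic n \<rho>" "integral_monic n \<rho>'"
    and "envelope_close \<rho> \<rho>'" "envelope_close \<rho>' \<rho>"
  shows "newton_segments v \<rho> = newton_segments v \<rho>'"
proof -
  have "newton_segments v \<rho> \<subseteq> newton_segments v \<rho>'"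
    if "integral_monic n \<rho>" "envelope_close \<rho> \<rho>'" "newton_polygon v \<rho> = newton_polygon v \<rho>'" for \<rho> \<rho>'
  proof
    fix z assume "z \<in> newton_segments v \<rho>"
    moreover obtain k m where z: "z = (k, m)" by (cases z)
    ultimately have seg: "(k, m) \<in> newton_segments v \<rho>" by simp
    note ends = segment_values_eq[OF that(1,2) seg]
    have "newton_point v \<rho>' k = newton_point v \<rho> k" "newton_point v \<rho>' m = newton_point v \<rho> m"
      using ends by (auto simp: newton_point_def)
    then show "z \<in> newton_segments v \<rho>'"
      using seg ends unfolding newton_segments_def z Let_def that(3) by simp
  qed
  then show ?thesis using assms newton_polygon_eq[OF assms] by blast
qed

end

lemma segment_slope_props:
  fixes v :: "'a::field \<Rightarrow> int"
  assumes "segment_slope v \<rho> (k, m) = (h, e)" "k < m"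
  shows "e > 0" "h * int (m - k) = e * (v (coeff \<rho> k) - v (coeff \<rho> m))" "nat e dvd m - k"
proof -
  let ?d = "v (coeff \<rho> k) - v (coeff \<rho> m)"
  have q: "quotient_of (rat_of_int ?d / rat_of_nat (m - k)) = (h, e)"
    using assms(1) by (simp add: segment_slope_def)
  show e: "e > 0" using quotient_of_denom_pos[OF q] .
  have "rat_of_int ?d / rat_of_nat (m - k) = rat_of_int h / rat_of_int e" using quotient_of_div[OF q] .
  then have "rat_of_int (h * int (m - k)) = rat_of_int (e * ?d)"
    using e assms(2) by (simp add: field_simps)
  then show *: "h * int (m - k) = e * ?d" by (simp only: of_int_eq_iff)
  have "e dvd h * int (m - k)" unfolding * by simp
  then have "e dvd int (m - k)"
    using quotient_of_coprime[OF q] by (simp add: coprime_dvd_mult_right_iff coprime_commute)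
  then show "nat e dvd m - k" using e by (metis int_dvd_int_iff int_nat_eq less_le_not_le nat_0_le less_imp_le)
qed

section \<open>Residues\<close>

locale residue_extension = eisenstein_uniformizer F v vK e \<phi> \<alpha>
  for F :: "'k::field alg_closure set" and v vK e \<phi> \<alpha> +
  fixes \<pi> :: 'k and red :: "'k \<Rightarrow> 'r::field"
  assumes vK: "normalized_valuation_on UNIV vK" and \<pi>: "uniformizer vK \<pi>"
    and red: "residue_map vK \<pi> red"
begin

abbreviation OK :: "'k set" where "OK \<equiv> carrier (val_ring vK)"
abbreviation res :: "'k alg_closure \<Rightarrow> 'r" where "res \<equiv> residue_L vK red v"

lemma mem_OK: "c \<in> OK \<longleftrightarrow> to_ac c \<in> fid 0"
  using e_pos by (cases "c = 0") (auto simp: val_ring_def fid_def v_base base_mem zero_mem zero_le_mult_iff)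

lemma base_fid_1: "to_ac c \<in> fid 1 \<longleftrightarrow> c = 0 \<or> 1 \<le> vK c"
  using e_pos
  by (cases "c = 0") (auto simp: fid_def v_base base_mem zero_mem zero_less_mult_iff int_one_le_iff_zero_less)

lemma red_ring_hom: "red \<in> ring_hom (val_ring vK) ring_of_type_algebra"
  using red unfolding residue_map_def by blast

lemma red_hom:
  assumes "c \<in> OK" "d \<in> OK"
  shows "red (c + d) = red c + red d" "red (c * d) = red c * red d"
  using ring_hom_add[OF red_ring_hom assms] ring_hom_mult[OF red_ring_hom assms]
  by (simp_all add: val_ring_def ring_of_type_algebra_def)

lemma red_one: "red 1 = 1"
  using ring_hom_one[OF red_ring_hom] by (simp add: val_ring_def ring_of_type_algebra_def)

lemma red_eq_0_iff: "c \<in> OK \<Longrightarrow> red c = 0 \<longleftrightarrow> to_ac c \<in> fid 1"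
proof -
  assume c: "c \<in> OK"
  have "red c = 0 \<longleftrightarrow> c \<in> PIdl\<^bsub>val_ring vK\<^esub> \<pi>"
    using c red unfolding residue_map_def by blast
  also have "\<dots> \<longleftrightarrow> to_ac c \<in> fid 1"
    using \<pi> by (subst mem_PIdl_iff[OF vK]) (auto simp: uniformizer_def base_fid_1)
  finally show ?thesis .
qed

lemma red_cong:
  assumes "c \<in> OK" "d \<in> OK" "to_ac c - to_ac d \<in> fid 1"
  shows "red c = red d"
proof -
  have cd: "c - d \<in> OK" using assms fid_diff by (simp add: mem_OK)
  have "red c = red (c - d + d)" by simp
  also have "\<dots> = red (c - d) + red d" using cd assms(2) by (rule red_hom)
  also have "red (c - d) = 0" using red_eq_0_iff[OF cd] assms(3) by simp
  finally show ?thesis by simp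
qed

lemma res_eqI:
  assumes "x \<in> F" "c \<in> OK" "x - to_ac c \<in> fid 1"
  shows "res x = red c"
  unfolding residue_L_def
proof (rule the_equality)
  show "\<exists>c'\<in>OK. (x = to_ac c' \<or> 0 < v (x - to_ac c')) \<and> red c = red c'"
    using assms by (intro bexI[of _ c]) (auto simp: fid_def)
  fix r assume "\<exists>c'\<in>OK. (x = to_ac c' \<or> 0 < v (x - to_ac c')) \<and> r = red c'"
  then obtain c' where c': "c' \<in> OK" "x = to_ac c' \<or> 0 < v (x - to_ac c')" "r = red c'" by blast
  have "x - to_ac c' \<in> fid 1"
    using c'(2) diff_mem[OF assms(1) base_mem[of c']] unfolding fid_def by auto
  from fid_diff[OF this assms(3)] have "to_ac c - to_ac c' \<in> fid 1" by simp
  then show "r = red c" using red_cong[OF assms(2) c'(1)] c'(3) by simp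
qed

lemma resE:
  assumes "x \<in> fid 0"
  obtains c where "c \<in> OK" "x - to_ac c \<in> fid 1" "res x = red c"
proof -
  obtain f where "coeff f 0 = 0 \<or> 0 \<le> vK (coeff f 0)" "x - to_ac (coeff f 0) \<in> fid 1"
    using integral_expansion[OF assms] by metis
  then show ?thesis
    using res_eqI[of x "coeff f 0"] fid_mem[OF assms] that[of "coeff f 0"] by (simp add: val_ring_def)
qed

lemma res_cong:
  assumes "x \<in> fid 0" "y - x \<in> fid 1"
  shows "res y = res x"
proof -
  obtain c where c: "c \<in> OK" "x - to_ac c \<in> fid 1" "res x = red c" using assms(1) by (rule resE)
  have "y = (y - x) + x" by simp
  then have "y \<in> F" using add_mem[OF fid_mem[OF assms(2)] fid_mem[OF assms(1)]] by simp
  moreover have "y - to_ac c \<in> fid 1" using fid_add[OF assms(2) c(2)] by simp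
  ultimately show ?thesis using res_eqI c by simp
qed

lemma res_mult:
  assumes "x \<in> fid 0" "y \<in> fid 0"
  shows "res (x * y) = res x * res y"
proof -
  obtain c where c: "c \<in> OK" "x - to_ac c \<in> fid 1" "res x = red c" using assms(1) by (rule resE)
  obtain d where d: "d \<in> OK" "y - to_ac d \<in> fid 1" "res y = red d" using assms(2) by (rule resE)
  have "x * y - to_ac (c * d) = (x - to_ac c) * y + to_ac c * (y - to_ac d)"
    by (simp add: algebra_simps)
  also have "\<dots> \<in> fid 1"
    using fid_mult[OF c(2) assms(2)] fid_mult[OF _ d(2), of "to_ac c" 0] c(1)
    by (intro fid_add) (auto simp: mem_OK)
  finally have "res (x * y) = red (c * d)"
    using assms fid_mult[of "to_ac c" 0 "to_ac d" 0] c(1) d(1)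
    by (intro res_eqI mult_mem) (auto simp: mem_OK fid_def)
  then show ?thesis using red_hom(2) c d by simp
qed

lemma res_one: "res 1 = 1"
  using res_eqI[of 1 1] fid_one by (simp add: one_mem mem_OK red_one)

lemma res_eq_0_iff: "x \<in> fid 0 \<Longrightarrow> res x = 0 \<longleftrightarrow> x \<in> fid 1"
proof -
  assume "x \<in> fid 0"
  then obtain c where c: "c \<in> OK" "x - to_ac c \<in> fid 1" "res x = red c" by (rule resE)
  have "x \<in> fid 1 \<longleftrightarrow> to_ac c \<in> fid 1"
    using fid_diff[OF _ c(2), of x] fid_add[OF c(2), of "to_ac c"] by auto
  then show ?thesis using red_eq_0_iff c by simp
qed

lemma res_unit:
  assumes "x \<in> F" "x \<noteq> 0" "v x = 0"
  shows "res x \<noteq> 0" "res (x powi t) = res x powi t"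
proof -
  have x: "x \<in> fid 0" "x \<notin> fid 1" using assms by (auto simp: fid_def)
  show "res x \<noteq> 0" using res_eq_0_iff x by simp
  have x': "inverse x \<in> fid 0" using assms by (simp add: fid_def inverse_mem v_inverse)
  have "res x * res (inverse x) = 1" using res_mult[OF x(1) x'] assms(2) res_one by simp
  then have inv: "res (inverse x) = inverse (res x)" by (simp add: inverse_unique)
  have pow: "res (y ^ n) = res y ^ n" if "y \<in> fid 0" for y n
  proof (induction n)
    case (Suc n)
    have "y ^ n \<in> fid 0" by (induction n) (use fid_mult[OF that, of _ 0] in auto)
    then show ?case using Suc res_mult[OF that] by simp
  qed (simp add: res_one)
  show "res (x powi t) = res x powi t"
    using pow x(1) x' inv by (simp add: power_int_def)
qed

end

section \<open>Residual polynomials of two uniformizers\<close>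

lemma gamma_twist_degree:
  assumes "\<And>s. s \<in> set xs \<Longrightarrow> degree (B s) = degree (A s)"
  shows "gamma \<epsilon> (map (\<lambda>s. (h s, B s)) xs) = gamma \<epsilon> (map (\<lambda>s. (h s, A s)) xs)"
  using assms by (induction xs) auto

lemma gamma_mult:
  "\<delta> \<noteq> 0 \<Longrightarrow> \<epsilon> \<noteq> 0 \<Longrightarrow> gamma (\<epsilon> * \<delta>) xs = gamma \<epsilon> xs * gamma \<delta> xs"
proof (induction xs)
  case (Cons x xs)
  then show ?case by (cases x) (simp add: power_int_mult_distrib)
qed simp

text \<open>The exponents of \<open>\<gamma>\<close> are the drops along the segments, so they telescope to the height of
  the left end point.\<close>

lemma gamma_telescope:
  assumes "\<delta> \<noteq> 0"
    and "successively (\<lambda>s s'. snd s = fst s') xs" "xs \<noteq> [] \<Longrightarrow> y (snd (last xs)) = 0"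
    and "\<And>s. s \<in> set xs \<Longrightarrow> h s * int (degree (A s)) = y (fst s) - y (snd s)"
  shows "xs \<noteq> [] \<Longrightarrow> gamma \<delta> (map (\<lambda>s. (h s, A s)) xs) = \<delta> powi (- y (fst (hd xs)))"
  using assms(2-)
proof (induction xs)
  case (Cons s xs)
  have s: "- h s * int (degree (A s)) = y (snd s) - y (fst s)" using Cons.prems(4)[of s] by simp
  show ?case
  proof (cases "xs = []")
    case True
    then show ?thesis using s Cons.prems(3) by simp
  next
    case False
    have "gamma \<delta> (map (\<lambda>s. (h s, A s)) xs) = \<delta> powi (- y (fst (hd xs)))"
      using Cons.prems False by (intro Cons.IH) (auto simp: successively_Cons)
    moreover have "fst (hd xs) = snd s" using Cons.prems(2) False by (simp add: successively_Cons)
    ultimately show ?thesis using s assms(1) by (simp add: power_int_add[symmetric])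
  qed
qed simp

text \<open>The factors \<open>\<gamma>\<close> are multiplicative in the twisting parameter. So they absorb a rescaling by
  \<open>\<delta>\<close> whose constants are the powers of \<open>\<delta>\<close> to the heights of the left end points.\<close>

lemma twist_rescaled:
  assumes "\<delta> \<noteq> 0" "\<epsilon> \<noteq> 0"
    and "successively (\<lambda>s s'. snd s = fst s') xs" "xs \<noteq> [] \<Longrightarrow> y (snd (last xs)) = 0"
    and "\<And>s. s \<in> set xs \<Longrightarrow> h s * int (degree (A s)) = y (fst s) - y (snd s)"
    and "\<And>s. s \<in> set xs \<Longrightarrow> B s = smult (\<delta> powi (- y (fst s))) (pcompose (A s) [:0, \<delta> powi h s:])"
  shows "twist \<epsilon> (map (\<lambda>s. (h s, B s)) xs) = twist (\<epsilon> * \<delta>) (map (\<lambda>s. (h s, A s)) xs)"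
  using assms(3-)
proof (induction xs)
  case (Cons s xs)
  let ?A = "map (\<lambda>s. (h s, A s))" and ?B = "map (\<lambda>s. (h s, B s))"
  have deg: "degree (B s') = degree (A s')" if "s' \<in> set (s # xs)" for s'
    using Cons.prems(4)[OF that] assms(1) by (simp add: degree_pcompose)
  have "gamma \<epsilon> (?B (s # xs)) * \<delta> powi (- y (fst s)) = gamma \<epsilon> (?A (s # xs)) * gamma \<delta> (?A (s # xs))"
    using gamma_twist_degree[where xs = "s # xs" and B = B and A = A and h = h and \<epsilon> = \<epsilon>, OF deg]
      gamma_telescope[OF assms(1) Cons.prems(1-3)]
    by simp
  also have "\<dots> = gamma (\<epsilon> * \<delta>) (?A (s # xs))"
    by (rule gamma_mult[OF assms(1,2), symmetric])
  finally have g: "gamma \<epsilon> (?B (s # xs)) * \<delta> powi (- y (fst s)) = gamma (\<epsilon> * \<delta>) (?A (s # xs))" .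
  have "pcompose (B s) [:0, \<epsilon> powi h s:] =
      smult (\<delta> powi (- y (fst s))) (pcompose (A s) [:0, (\<epsilon> * \<delta>) powi h s:])"
    using Cons.prems(4)[of s]
    by (simp add: pcompose_smult pcompose_assoc[symmetric] pcompose_pCons power_int_mult_distrib mult.commute)
  then have "smult (gamma \<epsilon> (?B (s # xs))) (pcompose (B s) [:0, \<epsilon> powi h s:]) =
      smult (gamma (\<epsilon> * \<delta>) (?A (s # xs))) (pcompose (A s) [:0, (\<epsilon> * \<delta>) powi h s:])"
    using g by (metis smult_smult)
  moreover have "twist \<epsilon> (?B xs) = twist (\<epsilon> * \<delta>) (?A xs)"
    using Cons.prems by (intro Cons.IH) (auto simp: successively_Cons split: if_splits)
  ultimately show ?case by (simp only: list.map twist.simps)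
qed simp

lemma coeff_residual_poly:
  assumes "segment_slope v \<rho> (k, m) = (h, e)"
  shows "coeff (residual_poly vK red v \<alpha> \<rho> (k, m)) j =
    (if j \<le> (m - k) div nat e
     then residue_L vK red v (coeff \<rho> (j * nat e + k) * \<alpha> powi (int j * h - v (coeff \<rho> k))) else 0)"
  using assms by (simp add: residual_poly_def Let_def coeff_sum sum.delta)

context valued_subfield
begin

text \<open>The abscissa \<open>j e + k\<close> lies on the segment, where the polygon has the integral height
  \<open>v(\<rho>\<^sub>k) - j h\<close>; this height bounds all coefficients up to that abscissa.\<close>

lemma segment_point_fid:
  assumes \<rho>: "integral_monic n \<rho>" and seg: "(k, m) \<in> newton_segments v \<rho>"
    and slope: "segment_slope v \<rho> (k, m) = (h, e)" and j: "j \<le> (m - k) div nat e"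
    and i: "i \<le> j * nat e + k"
  shows "coeff \<rho> i \<in> fid (v (coeff \<rho> k) - int j * h)"
proof -
  have km: "k < m" "m \<le> n" using segment_bounds[OF seg] \<rho> by (auto simp: integral_monic_def)
  note sl = segment_slope_props[OF slope km(1)]
  define s where "s = - real_of_int h / real_of_int e"
  define c where "c = real_of_int (v (coeff \<rho> k)) - s * real k"
  have "real_of_int h * (real m - real k) =
      real_of_int e * (real_of_int (v (coeff \<rho> k)) - real_of_int (v (coeff \<rho> m)))"
    using arg_cong[OF sl(2), of real_of_int] km(1) by (simp add: of_nat_diff)
  then have "s * (real m - real k) = real_of_int (v (coeff \<rho> m)) - real_of_int (v (coeff \<rho> k))"
    using sl(1) by (simp add: s_def field_simps)
  then have ends: "newton_point v \<rho> k = (real k, c + s * real k)" "newton_point v \<rho> m = (real m, c + s * real m)"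
    by (auto simp: newton_point_def c_def algebra_simps)
  have "j * nat e \<le> (m - k) div nat e * nat e" using j by (rule mult_right_mono) simp
  also have "\<dots> \<le> m - k" by simp
  finally have jm: "j * nat e + k \<le> m" using km(1) by simp
  have "s * (real j * real_of_int e) = - (real j * real_of_int h)"
    using sl(1) by (simp add: s_def)
  then have "c + s * (real j * real_of_int e + real k) = real_of_int (v (coeff \<rho> k) - int j * h)"
    by (simp add: c_def algebra_simps)
  moreover have "real (j * nat e + k) = real j * real_of_int e + real k"
    using of_nat_nat[of e, where 'a = real] sl(1) by simp
  ultimately have y: "c + s * real (j * nat e + k) = real_of_int (v (coeff \<rho> k) - int j * h)"
    by (simp only:)
  have "(real (j * nat e + k), c + s * real (j * nat e + k))
      \<in> closed_segment (newton_point v \<rho> k) (newton_point v \<rho> m)"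
    unfolding ends using km(1) jm
    by (subst closed_segment_on_line) (simp_all del: of_nat_add of_nat_mult)
  also have "\<dots> \<subseteq> newton_polygon v \<rho>"
    using seg unfolding newton_segments_def Let_def by blast
  finally have "(real (j * nat e + k), real_of_int (v (coeff \<rho> k) - int j * h)) \<in> newton_polygon v \<rho>"
    unfolding y .
  from polygon_lower_bound[OF \<rho> this i] show ?thesis using jm km(2) by linarith
qed

end

context residue_extension
begin

lemma power_int_fid: "x \<in> F \<Longrightarrow> x \<noteq> 0 \<Longrightarrow> v x = 1 \<Longrightarrow> x powi t \<in> fid t"
  by (simp add: fid_def power_int_mem v_power_int)

lemma integral_monic_ramification: "integral_monic n (ramification_poly \<phi> \<alpha>)"
  using ramification_poly_integral by (simp add: integral_monic_def)

text \<open>The top coefficient belongs to the right end of the segment, which is a point of the polygon;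
  after scaling it has value 0, so its residue does not vanish.\<close>

lemma degree_residual_poly:
  assumes seg: "(k, m) \<in> newton_segments v (ramification_poly \<phi> \<alpha>)"
    and slope: "segment_slope v (ramification_poly \<phi> \<alpha>) (k, m) = (h, e')"
  shows "h * int (degree (residual_poly vK red v \<alpha> (ramification_poly \<phi> \<alpha>) (k, m))) =
    v (coeff (ramification_poly \<phi> \<alpha>) k) - v (coeff (ramification_poly \<phi> \<alpha>) m)"
proof -
  let ?\<rho> = "ramification_poly \<phi> \<alpha>" and ?A = "residual_poly vK red v \<alpha> (ramification_poly \<phi> \<alpha>) (k, m)"
  let ?d = "(m - k) div nat e'"
  have km: "k < m" "coeff ?\<rho> m \<noteq> 0" using segment_bounds[OF seg] by auto
  note sl = segment_slope_props[OF slope km(1)]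
  have de: "?d * nat e' = m - k" using sl(3) by simp
  have "int ?d * e' = int (m - k)" using arg_cong[OF de, of int] sl(1) by simp
  then have "h * (int ?d * e') = e' * (v (coeff ?\<rho> k) - v (coeff ?\<rho> m))"
    using sl(2) by (simp only:)
  then have "e' * (h * int ?d) = e' * (v (coeff ?\<rho> k) - v (coeff ?\<rho> m))"
    by (simp only: mult.assoc mult.commute mult.left_commute)
  then have hd: "h * int ?d = v (coeff ?\<rho> k) - v (coeff ?\<rho> m)" using sl(1) by simp
  have \<rho>F: "coeff ?\<rho> m \<in> F"
    using ramification_poly_integral(1) by (auto simp: pfid_def fid_def)
  have "coeff ?A ?d = res (coeff ?\<rho> m * \<alpha> powi (- v (coeff ?\<rho> m)))"
    using coeff_residual_poly[OF slope, of vK red \<alpha> ?d] de km(1) hd by (simp add: mult.commute)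
  also have "\<dots> \<noteq> 0"
    using \<rho>F km(2) root_mem root_nonzero v_root
    by (intro res_unit mult_mem power_int_mem) (auto simp: v_mult power_int_mem v_power_int)
  finally have "?d \<le> degree ?A" by (rule le_degree)
  moreover have "degree ?A \<le> ?d"
    using coeff_residual_poly[OF slope, of vK red \<alpha>] by (intro degree_le) auto
  ultimately show ?thesis using hd by simp
qed

text \<open>The coefficients on the polygon agree modulo the maximal ideal after scaling, so only the
  choice of the uniformizer in the scaling factor matters.\<close>

lemma residual_poly_change:
  assumes \<psi>: "eisenstein_uniformizer F v vK e \<psi> \<beta>"
    and seg: "(k, m) \<in> newton_segments v (ramification_poly \<phi> \<alpha>)"
    and slope: "segment_slope v (ramification_poly \<phi> \<alpha>) (k, m) = (h, e')"
      "segment_slope v (ramification_poly \<psi> \<beta>) (k, m) = (h, e')"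
  defines "\<delta> \<equiv> res (\<beta> / \<alpha>)"
  shows "residual_poly vK red v \<beta> (ramification_poly \<psi> \<beta>) (k, m) =
    smult (\<delta> powi (- v (coeff (ramification_poly \<phi> \<alpha>) k)))
      (pcompose (residual_poly vK red v \<alpha> (ramification_poly \<phi> \<alpha>) (k, m)) [:0, \<delta> powi h:])"
proof (rule poly_eqI)
  fix j
  interpret B: eisenstein_uniformizer F v vK e \<psi> \<beta> by fact
  let ?\<rho> = "ramification_poly \<phi> \<alpha>" and ?\<rho>' = "ramification_poly \<psi> \<beta>"
  let ?i = "j * nat e' + k" and ?t = "int j * h - v (coeff ?\<rho> k)"
  note close = ramification_polys_close(1)[OF \<psi>]
  have vk: "v (coeff ?\<rho>' k) = v (coeff ?\<rho> k)"
    by (rule segment_values_eq[OF integral_monic_ramification close seg])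
  have u: "\<beta> / \<alpha> \<in> F" "\<beta> / \<alpha> \<noteq> 0" "v (\<beta> / \<alpha>) = 0"
    using root_mem root_nonzero v_root B.root_mem B.root_nonzero B.v_root
    by (auto simp: divide_inverse mult_mem inverse_mem v_mult v_inverse)
  have \<delta>: "\<delta> \<noteq> 0" unfolding \<delta>_def using u by (rule res_unit)
  have main: "res (coeff ?\<rho>' ?i * \<beta> powi ?t) = res (coeff ?\<rho> ?i * \<alpha> powi ?t) * \<delta> powi ?t"
    if j: "j \<le> (m - k) div nat e'"
  proof -
    have low: "coeff ?\<rho> i \<in> fid (- ?t)" if "i \<le> ?i" for i
      using segment_point_fid[OF integral_monic_ramification seg slope(1) j that] by simp
    have \<beta>t: "\<beta> powi ?t \<in> fid ?t"
      using B.root_mem B.root_nonzero B.v_root by (rule power_int_fid)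
    have \<alpha>t: "\<alpha> powi ?t \<in> fid ?t"
      using root_mem root_nonzero v_root by (rule power_int_fid)
    have "coeff ?\<rho>' ?i - coeff ?\<rho> ?i \<in> fid (- ?t + 1)"
      using low by (rule envelope_closeD[OF close])
    from fid_mult[OF this \<beta>t]
    have "coeff ?\<rho>' ?i * \<beta> powi ?t - coeff ?\<rho> ?i * \<beta> powi ?t \<in> fid 1"
      by (simp add: left_diff_distrib)
    moreover have "coeff ?\<rho> ?i * \<beta> powi ?t \<in> fid 0" "coeff ?\<rho> ?i * \<alpha> powi ?t \<in> fid 0"
      using fid_mult[OF low[OF order_refl] \<beta>t] fid_mult[OF low[OF order_refl] \<alpha>t] by auto
    moreover have "(\<beta> / \<alpha>) powi ?t \<in> fid 0"
      using u by (simp add: fid_def power_int_mem v_power_int)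
    moreover have "\<beta> powi ?t = \<alpha> powi ?t * (\<beta> / \<alpha>) powi ?t"
      using root_nonzero by (simp add: power_int_divide_distrib)
    ultimately have "res (coeff ?\<rho>' ?i * \<beta> powi ?t) =
        res (coeff ?\<rho> ?i * \<alpha> powi ?t) * res ((\<beta> / \<alpha>) powi ?t)"
      using res_cong res_mult by (metis mult.assoc)
    then show ?thesis using res_unit(2)[OF u] by (simp add: \<delta>_def)
  qed
  have "\<delta> powi ?t = \<delta> powi (- v (coeff ?\<rho> k)) * (\<delta> powi h) ^ j"
  proof -
    have "\<delta> powi ?t = \<delta> powi (- v (coeff ?\<rho> k) + h * int j)" by (simp add: mult.commute)
    also have "\<dots> = \<delta> powi (- v (coeff ?\<rho> k)) * \<delta> powi (h * int j)"
      by (rule power_int_add) (use \<delta> in simp)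
    finally show ?thesis by (simp only: power_int_mult power_int_of_nat)
  qed
  then show "coeff (residual_poly vK red v \<beta> ?\<rho>' (k, m)) j =
      coeff (smult (\<delta> powi (- v (coeff ?\<rho> k))) (pcompose (residual_poly vK red v \<alpha> ?\<rho> (k, m)) [:0, \<delta> powi h:])) j"
    using main coeff_residual_poly[OF slope(1), of vK red \<alpha> j]
      coeff_residual_poly[OF slope(2), of vK red \<beta> j] vk
    by (simp add: coeff_pcompose_linear mult.commute mult.left_commute)
qed

text \<open>With \<open>\<delta>\<close> the residue of \<open>\<beta> / \<alpha>\<close>, twisting by \<open>\<epsilon>\<close> after passing to \<open>\<beta>\<close> is twisting by \<open>\<epsilon> \<delta>\<close>,
  and \<open>\<epsilon> \<mapsto> \<epsilon> \<delta>\<close> permutes the nonzero residues.\<close>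

theorem residual_invariant_change_uniformizer:
  assumes \<psi>: "eisenstein_uniformizer F v vK e \<psi> \<beta>"
  shows "residual_invariant vK red \<psi> \<beta> v = residual_invariant vK red \<phi> \<alpha> v"
proof -
  interpret B: eisenstein_uniformizer F v vK e \<psi> \<beta> by fact
  let ?\<rho> = "ramification_poly \<phi> \<alpha>" and ?\<rho>' = "ramification_poly \<psi> \<beta>"
  have n: "degree \<psi> = n" using e_eq B.e_eq by simp
  note close = ramification_polys_close[OF \<psi>]
  have mon: "integral_monic n ?\<rho>'"
    using B.ramification_poly_integral n by (simp add: integral_monic_def)
  note mon' = integral_monic_ramification
  define xs where "xs = newton_segment_list v ?\<rho>"
  have list: "newton_segment_list v ?\<rho>' = xs"
    using newton_segments_eq[OF mon' mon close] by (simp add: xs_def newton_segment_list_def)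
  have set: "set xs = newton_segments v ?\<rho>" by (simp add: xs_def segment_list)
  define h where "h s = fst (segment_slope v ?\<rho> s)" for s
  have slope: "segment_slope v ?\<rho>' s = segment_slope v ?\<rho> s" if "s \<in> set xs" for s
  proof -
    obtain k m where s: "s = (k, m)" by (cases s)
    show ?thesis
      using segment_values_eq[OF mon' close(1), of k m] that unfolding s set
      by (simp add: segment_slope_def)
  qed
  define \<delta> where "\<delta> = res (\<beta> / \<alpha>)"
  have \<delta>: "\<delta> \<noteq> 0"
    unfolding \<delta>_def using root_mem root_nonzero v_root B.root_mem B.root_nonzero B.v_root
    by (intro res_unit) (auto simp: divide_inverse mult_mem inverse_mem v_mult v_inverse)
  define P where "P = map (\<lambda>s. (h s, residual_poly vK red v \<alpha> ?\<rho> s)) xs"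
  define Q where "Q = map (\<lambda>s. (h s, residual_poly vK red v \<beta> ?\<rho>' s)) xs"
  have P: "slopes_and_residual_polys vK red \<phi> \<alpha> v = P"
    by (simp add: slopes_and_residual_polys_def P_def h_def xs_def Let_def)
  have Q: "slopes_and_residual_polys vK red \<psi> \<beta> v = Q"
    by (auto simp: slopes_and_residual_polys_def Q_def h_def list Let_def slope)
  have tw: "twist \<epsilon> Q = twist (\<epsilon> * \<delta>) P" if "\<epsilon> \<noteq> 0" for \<epsilon>
    unfolding P_def Q_def
  proof (rule twist_rescaled[OF \<delta> that, where y = "\<lambda>i. v (coeff ?\<rho> i)"])
    show "successively (\<lambda>s s'. snd s = fst s') xs"
      unfolding xs_def by (rule segment_list_contiguous)
    show "v (coeff ?\<rho> (snd (last xs))) = 0" if "xs \<noteq> []"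
      using segment_list_contiguous(2)[of v ?\<rho>] that ramification_poly_integral v_one
      by (simp add: xs_def)
    fix s assume s: "s \<in> set xs"
    obtain k m where km: "s = (k, m)" by (cases s)
    obtain e' where e': "segment_slope v ?\<rho> (k, m) = (h s, e')"
      by (metis h_def km prod.collapse)
    have seg: "(k, m) \<in> newton_segments v ?\<rho>" using s set km by simp
    show "h s * int (degree (residual_poly vK red v \<alpha> ?\<rho> s)) =
        v (coeff ?\<rho> (fst s)) - v (coeff ?\<rho> (snd s))"
      using degree_residual_poly[OF seg e'] by (simp add: km)
    show "residual_poly vK red v \<beta> ?\<rho>' s =
        smult (\<delta> powi (- v (coeff ?\<rho> (fst s)))) (pcompose (residual_poly vK red v \<alpha> ?\<rho> s) [:0, \<delta> powi h s:])"
      using residual_poly_change[OF \<psi> seg e'] slope[OF s] e' by (simp add: km \<delta>_def)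
  qed
  have "{twist \<epsilon> Q |\<epsilon>. \<epsilon> \<noteq> 0} = {twist \<epsilon> P |\<epsilon>. \<epsilon> \<noteq> 0}"
  proof (intro subset_antisym subsetI)
    fix z assume "z \<in> {twist \<epsilon> Q |\<epsilon>. \<epsilon> \<noteq> 0}"
    then obtain \<epsilon> where "\<epsilon> \<noteq> 0" "z = twist \<epsilon> Q" by blast
    then have "\<epsilon> * \<delta> \<noteq> 0 \<and> z = twist (\<epsilon> * \<delta>) P" using tw \<delta> by simp
    then show "z \<in> {twist \<epsilon> P |\<epsilon>. \<epsilon> \<noteq> 0}" by blast
  next
    fix z assume "z \<in> {twist \<epsilon> P |\<epsilon>. \<epsilon> \<noteq> 0}"
    then obtain \<epsilon> where "\<epsilon> \<noteq> 0" "z = twist \<epsilon> P" by blast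
    then have "\<epsilon> / \<delta> \<noteq> 0 \<and> z = twist (\<epsilon> / \<delta>) Q" using tw[of "\<epsilon> / \<delta>"] \<delta> by simp
    then show "z \<in> {twist \<epsilon> Q |\<epsilon>. \<epsilon> \<noteq> 0}" by blast
  qed
  then show ?thesis by (simp add: residual_invariant_def P Q)
qed

end

section \<open>Conjugate roots\<close>

text \<open>Two elements that satisfy the same polynomial relations over \<open>K\<close>, with the valuations of
  \<open>K(\<alpha>)\<close> and \<open>K(\<alpha>')\<close> matched by the resulting isomorphism. The
  isomorphism is used through its graph, so that it need not be shown to be well defined.\<close>

locale conjugate_roots =
  fixes \<alpha> \<alpha>' :: "'k::field alg_closure" and v v' :: "'k alg_closure \<Rightarrow> int"
  assumes zero_iff: "ev f \<alpha> = 0 \<longleftrightarrow> ev f \<alpha>' = 0"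
    and v_eq: "ev f \<alpha> \<noteq> 0 \<Longrightarrow> v (ev f \<alpha>) = v' (ev f \<alpha>')"
begin

definition conjugate :: "'k alg_closure \<Rightarrow> 'k alg_closure \<Rightarrow> bool" where
  "conjugate x y \<longleftrightarrow> (\<exists>f. x = ev f \<alpha> \<and> y = ev f \<alpha>')"

lemma conj_base: "conjugate (to_ac c) (to_ac c)"
  unfolding conjugate_def by (rule exI[of _ "[:c:]"]) simp

lemma conj_root: "conjugate \<alpha> \<alpha>'"
  unfolding conjugate_def by (rule exI[of _ "[:0, 1:]"]) simp

lemma conj_add: "conjugate x y \<Longrightarrow> conjugate x' y' \<Longrightarrow> conjugate (x + x') (y + y')"
  unfolding conjugate_def by (metis poly_add up_add)

lemma conj_diff: "conjugate x y \<Longrightarrow> conjugate x' y' \<Longrightarrow> conjugate (x - x') (y - y')"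
  unfolding conjugate_def by (metis poly_diff up_diff)

lemma conj_mult: "conjugate x y \<Longrightarrow> conjugate x' y' \<Longrightarrow> conjugate (x * x') (y * y')"
  unfolding conjugate_def by (metis poly_mult up_mult)

lemma conj_zero_iff: "conjugate x y \<Longrightarrow> x = 0 \<longleftrightarrow> y = 0"
  using zero_iff by (auto simp: conjugate_def)

lemma conj_v: "conjugate x y \<Longrightarrow> x \<noteq> 0 \<Longrightarrow> v x = v' y"
  using v_eq by (auto simp: conjugate_def)

lemma conj_0: "conjugate 0 0"
  using conj_base[of 0] by simp

lemma conj_1: "conjugate 1 1"
  using conj_base[of 1] by simp

lemma conj_inverse:
  assumes "conjugate x y" shows "conjugate (inverse x) (inverse y)"
proof (cases "x = 0")
  case True
  then show ?thesis using conj_zero_iff[OF assms] conj_0 by simp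
next
  case False
  obtain f where f: "x = ev f \<alpha>" "y = ev f \<alpha>'" using assms by (auto simp: conjugate_def)
  obtain q where q: "inverse x = ev q x" using inverse_eq_ev by blast
  let ?g = "pcompose q f"
  have g: "inverse x = ev ?g \<alpha>" using q f by (simp add: poly_pcompose)
  then have "ev f \<alpha> * ev ?g \<alpha> = 1" using False f(1) by (metis right_inverse)
  then have "ev (f * ?g - 1) \<alpha> = 0" by simp
  then have "ev (f * ?g - 1) \<alpha>' = 0" using zero_iff by blast
  then have "y * ev ?g \<alpha>' = 1" using f(2) by simp
  then have "inverse y = ev ?g \<alpha>'" by (rule inverse_unique)
  with g show ?thesis unfolding conjugate_def by blast
qed

lemma conj_power: "conjugate x y \<Longrightarrow> conjugate (x ^ i) (y ^ i)"
  by (induction i) (auto intro: conj_1 conj_mult)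

lemma conj_power_int: "conjugate x y \<Longrightarrow> conjugate (x powi i) (y powi i)"
  by (simp add: power_int_def conj_power conj_inverse)

lemma conj_sum: "(\<And>i. i \<in> I \<Longrightarrow> conjugate (f i) (g i)) \<Longrightarrow> conjugate (\<Sum>i\<in>I. f i) (\<Sum>i\<in>I. g i)"
  by (induction I rule: infinite_finite_induct) (auto intro: conj_0 conj_add)

lemma conj_taylor: "conjugate (coeff (pcompose (up f) [:\<alpha>, \<alpha>:]) i) (coeff (pcompose (up f) [:\<alpha>', \<alpha>':]) i)"
proof (induction f arbitrary: i)
  case (pCons c f)
  have lin: "conjugate (coeff [:\<alpha>, \<alpha>:] j) (coeff [:\<alpha>', \<alpha>':] j)" for j
    by (auto simp: coeff_pCons conj_root conj_0 split: nat.split)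
  have const: "conjugate (coeff [:to_ac c:] j) (coeff [:to_ac c:] j)" for j
    by (auto simp: coeff_pCons conj_base conj_0 split: nat.split)
  show ?case
    unfolding up_pCons pcompose_pCons coeff_add coeff_mult
    by (intro conj_add const conj_sum conj_mult lin pCons.IH)
qed (simp add: conj_0)

lemma conj_ramification: "conjugate (coeff (ramification_poly f \<alpha>) i) (coeff (ramification_poly f \<alpha>') i)"
  unfolding ramification_poly_def coeff_smult
  by (intro conj_mult conj_inverse conj_power conj_root conj_taylor)

lemma residue_conj:
  assumes "conjugate x y"
  shows "residue_L vK red v x = residue_L vK red v' y"
proof -
  have "(x = to_ac c \<or> 0 < v (x - to_ac c)) \<longleftrightarrow> (y = to_ac c \<or> 0 < v' (y - to_ac c))" for c
    using conj_zero_iff[OF conj_diff[OF assms conj_base], of c] conj_v[OF conj_diff[OF assms conj_base], of c]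
    by auto
  then show ?thesis by (simp add: residue_L_def)
qed

text \<open>Every ingredient of the invariant is a field operation on \<open>\<alpha>\<close> and \<open>K\<close>, a value or a residue, and
  the isomorphism respects all of them.\<close>

lemma residual_invariant_conj:
  "residual_invariant vK red f \<alpha> v = residual_invariant vK red f \<alpha>' v'"
proof -
  let ?\<rho> = "ramification_poly f \<alpha>" and ?\<rho>' = "ramification_poly f \<alpha>'"
  have zero: "coeff ?\<rho>' i = 0 \<longleftrightarrow> coeff ?\<rho> i = 0" for i
    using conj_zero_iff[OF conj_ramification] by simp
  have val: "v' (coeff ?\<rho>' i) = v (coeff ?\<rho> i)" if "coeff ?\<rho> i \<noteq> 0" for i
    using conj_v[OF conj_ramification that] by simp
  have pt: "newton_point v' ?\<rho>' i = newton_point v ?\<rho> i" if "coeff ?\<rho> i \<noteq> 0" for i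
    using val[OF that] by (simp add: newton_point_def)
  have "newton_point v' ?\<rho>' ` support ?\<rho>' = newton_point v ?\<rho> ` support ?\<rho>"
    unfolding zero by (rule image_cong) (auto simp: pt)
  then have pol: "newton_polygon v' ?\<rho>' = newton_polygon v ?\<rho>" by (simp add: newton_polygon_def)
  have "(k, m) \<in> newton_segments v' ?\<rho>' \<longleftrightarrow> (k, m) \<in> newton_segments v ?\<rho>" for k m
  proof (cases "coeff ?\<rho> k = 0 \<or> coeff ?\<rho> m = 0")
    case True
    then show ?thesis by (auto simp: newton_segments_def zero)
  next
    case False
    then show ?thesis using pt[of k] pt[of m]
      unfolding newton_segments_def mem_Collect_eq case_prod_conv zero pol Let_def by simp
  qed
  then have segs: "newton_segments v' ?\<rho>' = newton_segments v ?\<rho>" by auto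
  have slope: "segment_slope v' ?\<rho>' s = segment_slope v ?\<rho> s"
    and res: "residual_poly vK red v' \<alpha>' ?\<rho>' s = residual_poly vK red v \<alpha> ?\<rho> s"
    if s: "s \<in> newton_segments v ?\<rho>" for s
  proof -
    obtain k m where km: "s = (k, m)" by (cases s)
    have k: "v' (coeff ?\<rho>' k) = v (coeff ?\<rho> k)" "v' (coeff ?\<rho>' m) = v (coeff ?\<rho> m)"
      using segment_bounds[of k m v ?\<rho>] s km val by auto
    show slope: "segment_slope v' ?\<rho>' s = segment_slope v ?\<rho> s"
      by (simp add: segment_slope_def km k)
    have "residue_L vK red v' (coeff ?\<rho>' i * \<alpha>' powi t) = residue_L vK red v (coeff ?\<rho> i * \<alpha> powi t)" for i t
      by (intro residue_conj[symmetric] conj_mult conj_ramification conj_power_int conj_root)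
    then show "residual_poly vK red v' \<alpha>' ?\<rho>' s = residual_poly vK red v \<alpha> ?\<rho> s"
      using slope by (simp add: residual_poly_def km k)
  qed
  have "newton_segment_list v' ?\<rho>' = newton_segment_list v ?\<rho>"
    by (simp add: newton_segment_list_def segs)
  then have "slopes_and_residual_polys vK red f \<alpha>' v' = slopes_and_residual_polys vK red f \<alpha> v"
    by (auto simp: slopes_and_residual_polys_def Let_def slope res segment_list(1))
  then show ?thesis by (simp add: residual_invariant_def)
qed

end

section \<open>Isomorphic quotients\<close>

lemma ring_of_poly: "cring (ring_of_type_algebra :: 'k::field poly ring)"
  by (rule cring_from_type_algebra)

lemma ideal_PIdl: "ideal (PIdl\<^bsub>ring_of_type_algebra\<^esub> (f :: 'k::field poly)) ring_of_type_algebra"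
  by (rule cring.cgenideal_ideal[OF ring_of_poly]) (simp add: ring_of_type_algebra_def)

lemma poly_class_eq_iff: "poly_class f g = poly_class f h \<longleftrightarrow> f dvd g - h"
proof -
  have cl: "poly_class f g = {q * f + g |q. True}" for g
    by (auto simp: poly_class_def a_r_coset_def r_coset_def cgenideal_def ring_of_type_algebra_def)
  show ?thesis
  proof
    assume "poly_class f g = poly_class f h"
    moreover have "0 * f + g \<in> poly_class f g" unfolding cl by blast
    ultimately obtain q where "0 * f + g = q * f + h" unfolding cl by blast
    then have "g - h = f * q" by (simp add: mult.commute)
    then show "f dvd g - h" by simp
  next
    assume "f dvd g - h"
    then obtain q where "g - h = f * q" by (elim dvdE)
    then have "g = q * f + h" by (simp add: algebra_simps)
    then have "r * f + g = (r + q) * f + h" "r * f + h = (r - q) * f + g" for r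
      by (simp_all add: algebra_simps)
    then show "poly_class f g = poly_class f h" unfolding cl by blast
  qed
qed

lemma poly_class_hom: "poly_class f \<in> ring_hom ring_of_type_algebra (poly_quot f)"
  using ideal.rcos_ring_hom[OF ideal_PIdl] unfolding poly_class_def[abs_def] poly_quot_def .

lemma carrier_poly_quot: "carrier (poly_quot f) = range (poly_class f)"
  by (auto simp: poly_quot_def poly_class_def FactRing_def A_RCOSETS_def' ring_of_type_algebra_def)

lemma poly_class_ops:
  "poly_class f (g + h) = poly_class f g \<oplus>\<^bsub>poly_quot f\<^esub> poly_class f h"
  "poly_class f (g * h) = poly_class f g \<otimes>\<^bsub>poly_quot f\<^esub> poly_class f h"
  using ring_hom_add[OF poly_class_hom, of g h f] ring_hom_mult[OF poly_class_hom, of g h f]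
  by (simp_all add: ring_of_type_algebra_def)

text \<open>If \<open>a\<close> represents the preimage of the class of \<open>x\<close>, then the inverse isomorphism is
  \<open>f \<mapsto> f \<circ> a\<close>. So \<open>a(\<beta>)\<close> is a root of \<open>\<phi>\<close> in \<open>K(\<beta>)\<close>, and it generates \<open>K(\<beta>)\<close>.\<close>

lemma iso_generator:
  assumes "poly_quot_iso_over_K \<psi> \<phi>"
  obtains a g where "\<psi> dvd pcompose \<phi> a" "\<psi> dvd pcompose g a - [:0, 1:]"
proof -
  obtain h where h: "h \<in> ring_iso (poly_quot \<psi>) (poly_quot \<phi>)"
    and const: "\<And>c. h (poly_class \<psi> [:c:]) = poly_class \<phi> [:c:]"
    using assms unfolding poly_quot_iso_over_K_def by blast
  have hom: "h \<in> ring_hom (poly_quot \<psi>) (poly_quot \<phi>)"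
    and bij: "bij_betw h (range (poly_class \<psi>)) (range (poly_class \<phi>))"
    using h by (auto simp: ring_iso_def carrier_poly_quot)
  have "poly_class \<phi> [:0, 1:] \<in> h ` range (poly_class \<psi>)"
    using bij by (simp add: bij_betw_def)
  then obtain a where a: "h (poly_class \<psi> a) = poly_class \<phi> [:0, 1:]" by auto
  have hom_ops: "h (poly_class \<psi> (x + y)) = h (poly_class \<psi> x) \<oplus>\<^bsub>poly_quot \<phi>\<^esub> h (poly_class \<psi> y)"
    "h (poly_class \<psi> (x * y)) = h (poly_class \<psi> x) \<otimes>\<^bsub>poly_quot \<phi>\<^esub> h (poly_class \<psi> y)" for x y
    unfolding poly_class_ops
    by (rule ring_hom_add[OF hom] ring_hom_mult[OF hom]; simp add: carrier_poly_quot)+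
  have comp: "h (poly_class \<psi> (pcompose f a)) = poly_class \<phi> f" for f
  proof (induction f)
    case 0
    then show ?case using const[of 0] by simp
  next
    case (pCons c f)
    have "h (poly_class \<psi> (pcompose (pCons c f) a)) =
        h (poly_class \<psi> [:c:]) \<oplus>\<^bsub>poly_quot \<phi>\<^esub> (h (poly_class \<psi> a) \<otimes>\<^bsub>poly_quot \<phi>\<^esub> h (poly_class \<psi> (pcompose f a)))"
      unfolding pcompose_pCons hom_ops ..
    also have "\<dots> = poly_class \<phi> ([:c:] + [:0, 1:] * f)"
      unfolding const a pCons.IH by (simp only: poly_class_ops)
    also have "[:c:] + [:0, 1:] * f = pCons c f" by simp
    finally show ?case .
  qed
  have inj: "\<psi> dvd pcompose f a - g" if "poly_class \<phi> f = h (poly_class \<psi> g)" for f g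
  proof -
    have "h (poly_class \<psi> (pcompose f a)) = h (poly_class \<psi> g)" using that comp by simp
    then have "poly_class \<psi> (pcompose f a) = poly_class \<psi> g"
      using bij by (auto simp: bij_betw_def inj_on_def)
    then show ?thesis by (simp add: poly_class_eq_iff)
  qed
  have "poly_class \<phi> \<phi> = poly_class \<phi> [:0:]" by (simp add: poly_class_eq_iff)
  then have "\<psi> dvd pcompose \<phi> a - [:0:]" using const[of 0] by (intro inj) simp
  moreover have "h (poly_class \<psi> [:0, 1:]) \<in> range (poly_class \<phi>)"
    using bij by (intro bij_betwE[OF bij, rule_format]) simp
  then obtain g where "h (poly_class \<psi> [:0, 1:]) = poly_class \<phi> g" by blast
  then have "\<psi> dvd pcompose g a - [:0, 1:]" by (intro inj) simp
  ultimately show ?thesis using that by simp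
qed

section \<open>Invariance\<close>

theorem theorem4p8:
  fixes p :: nat
    and \<iota> :: "(nat \<Rightarrow> rat) set \<Rightarrow> 'k::field"
    and vK :: "'k \<Rightarrow> int"
    and \<pi> :: 'k
    and red :: "'k \<Rightarrow> 'r::field"
    and \<phi> \<psi> :: "'k poly"
    and \<alpha> \<beta> :: "'k alg_closure"
    and v\<^sub>\<alpha> v\<^sub>\<beta> :: "'k alg_closure \<Rightarrow> int"
  assumes "Factorial_Ring.prime p"
    and "finite_ext_of_Qp p \<iota>"
    and "valuation_of_K p \<iota> vK"
    and "uniformizer vK \<pi>"
    and "residue_map vK \<pi> red"
    and "eisenstein vK \<pi> \<phi>" and "is_root \<phi> \<alpha>" and "valuation_of_L vK \<alpha> v\<^sub>\<alpha>"
    and "eisenstein vK \<pi> \<psi>" and "is_root \<psi> \<beta>" and "valuation_of_L vK \<beta> v\<^sub>\<beta>"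
    and "poly_quot_iso_over_K \<psi> \<phi>"
  shows "residual_invariant vK red \<psi> \<beta> v\<^sub>\<beta> = residual_invariant vK red \<phi> \<alpha> v\<^sub>\<alpha>"
proof -
  have vK: "normalized_valuation_on UNIV vK"
    using assms(3) by (simp add: valuation_of_K_def)
  note eis = eisenstein_imp_coeffs[OF vK assms(4)]
  obtain e where e: "e > 0" "\<And>c. c \<noteq> 0 \<Longrightarrow> v\<^sub>\<alpha> (to_ac c) = e * vK c"
    and v\<alpha>: "normalized_valuation_on (adjoin_root \<alpha>) v\<^sub>\<alpha>" "v\<^sub>\<alpha> \<alpha> = 1"
    using assms(8) unfolding valuation_of_L_def by blast
  obtain e' where e': "e' > 0" "\<And>c. c \<noteq> 0 \<Longrightarrow> v\<^sub>\<beta> (to_ac c) = e' * vK c"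
    and v\<beta>: "normalized_valuation_on (adjoin_root \<beta>) v\<^sub>\<beta>" "v\<^sub>\<beta> \<beta> = 1"
    using assms(11) unfolding valuation_of_L_def by blast
  have base: "to_ac c \<in> adjoin_root x" for c :: 'k and x
    using adjoin_rootI[of "[:c:]" x] by simp
  interpret A: eisenstein_uniformizer "adjoin_root \<alpha>" v\<^sub>\<alpha> vK e \<phi> \<alpha>
    using valued_subfield_adjoin_root[OF v\<alpha>(1)] e v\<alpha>(2) base adjoin_root_self eis[OF assms(6)] assms(7)
    by (auto simp: eisenstein_uniformizer_def eisenstein_uniformizer_axioms_def eisenstein_root_def
        eisenstein_root_axioms_def valued_extension_def valued_extension_axioms_def is_root_def)
  interpret B: eisenstein_uniformizer "adjoin_root \<beta>" v\<^sub>\<beta> vK e' \<psi> \<beta>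
    using valued_subfield_adjoin_root[OF v\<beta>(1)] e' v\<beta>(2) base adjoin_root_self eis[OF assms(9)] assms(10)
    by (auto simp: eisenstein_uniformizer_def eisenstein_uniformizer_axioms_def eisenstein_root_def
        eisenstein_root_axioms_def valued_extension_def valued_extension_axioms_def is_root_def)
  obtain a g where a: "\<psi> dvd pcompose \<phi> a" and g: "\<psi> dvd pcompose g a - [:0, 1:]"
    using assms(12) by (rule iso_generator)
  \<comment> \<open>the image of \<open>\<alpha>\<close> under the isomorphism of \<open>K(\<alpha>)\<close> with \<open>K(\<beta>)\<close>\<close>
  define \<alpha>' where "\<alpha>' = ev a \<beta>"
  have \<alpha>': "\<alpha>' \<in> adjoin_root \<beta>" "ev \<phi> \<alpha>' = 0" "ev g \<alpha>' = \<beta>"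
  proof -
    show "\<alpha>' \<in> adjoin_root \<beta>" by (auto simp: \<alpha>'_def)
    have "ev (pcompose \<phi> a) \<beta> = 0" "ev (pcompose g a - [:0, 1:]) \<beta> = 0"
      using a g B.ev_eq_0_iff by blast+
    then show "ev \<phi> \<alpha>' = 0" "ev g \<alpha>' = \<beta>" by (simp_all add: \<alpha>'_def poly_pcompose)
  qed
  interpret C: eisenstein_root "adjoin_root \<beta>" v\<^sub>\<beta> vK e' \<phi> \<alpha>'
    using \<alpha>'(1,2) eis[OF assms(6)] by unfold_locales
  have \<beta>_mem: "\<beta> \<in> adjoin_root \<alpha>'" using adjoin_rootI[of g \<alpha>'] \<alpha>'(3) by simp
  have gen: "adjoin_root \<beta> = adjoin_root \<alpha>'"
    using adjoin_root_ev[OF \<alpha>'(1)] adjoin_root_ev[OF \<beta>_mem] by (metis adjoin_rootE subsetI subset_antisym)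
  have v\<alpha>': "v\<^sub>\<beta> \<alpha>' = 1" using C.v_root_eq_1[OF \<beta>_mem B.root_nonzero v\<beta>(2)] .
  interpret C: eisenstein_uniformizer "adjoin_root \<beta>" v\<^sub>\<beta> vK e' \<phi> \<alpha>'
    using gen v\<alpha>' by unfold_locales
  interpret C: residue_extension "adjoin_root \<beta>" v\<^sub>\<beta> vK e' \<phi> \<alpha>' \<pi> red
    using vK assms(4,5) by unfold_locales
  interpret conjugate_roots \<alpha> \<alpha>' v\<^sub>\<alpha> v\<^sub>\<beta>
  proof
    fix f
    show "ev f \<alpha> = 0 \<longleftrightarrow> ev f \<alpha>' = 0" by (simp add: A.ev_eq_0_iff C.ev_eq_0_iff)
    assume "ev f \<alpha> \<noteq> 0"
    then have "f mod \<phi> \<noteq> 0" by (auto simp: A.ev_eq_0_iff mod_eq_0_iff_dvd)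
    then show "v\<^sub>\<alpha> (ev f \<alpha>) = v\<^sub>\<beta> (ev f \<alpha>')"
      unfolding A.ev_mod[of f] C.ev_mod[of f]
      using A.v_ev(2)[OF _ A.degree_mod, of f] C.v_ev(2)[OF _ A.degree_mod, of f] v\<alpha>(2) v\<alpha>' by simp
  qed
  have "residual_invariant vK red \<psi> \<beta> v\<^sub>\<beta> = residual_invariant vK red \<phi> \<alpha>' v\<^sub>\<beta>"
    by (rule C.residual_invariant_change_uniformizer) unfold_locales
  also have "\<dots> = residual_invariant vK red \<phi> \<alpha> v\<^sub>\<alpha>"
    by (rule residual_invariant_conj[symmetric])
  finally show ?thesis .
qed

end
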